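(* Let $1\le m\le n$ and $d$ be integers. If $m+1\le n\le 2m-5$ and $\lceil\frac{m+n-4}{3}\rceil\le d\le m-3$, then $\tilde{H}_d(\mathsf{M}_{m,n};\mathbb{Z})$ contains an element of order $3$. Moreover, if $\lceil\frac{2m-4}{3}\rceil\le d\le m-4$, then $\tilde{H}_d(\mathsf{M}_{m,m};\mathbb{Z})$ contains an element of order $3$.
   Context: $\mathsf{M}_{m,n}$ denotes the chessboard complex: the simplicial complex whose faces are the matchings (sets of pairwise vertex-disjoint edges) in the complete bipartite graph $K_{m,n}$. $\tilde H$ denotes reduced simplicial homology. *)

theory Defs
  imports Complex_Main "HOL-Algebra.Free_Abelian_Groups" "HOL-Algebra.Multiplicative_Group"
begin

section \<open>Reduced simplicial homology with integer coefficients\<close>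

text \<open>
  An abstract simplicial complex is given by its set of faces, a family of finite sets closed
  under taking subsets. For reduced homology the empty face counts as a face, of dimension -1,
  and the boundary map from degree 0 to degree -1 below is then the augmentation.
  The linear order on the vertices only fixes an orientation of every face.
\<close>

definition abstract_simplicial_complex :: "'a set set \<Rightarrow> bool"
  where "abstract_simplicial_complex K \<longleftrightarrow>
    (\<forall>\<sigma>\<in>K. finite \<sigma> \<and> (\<forall>\<tau>. \<tau> \<subseteq> \<sigma> \<longrightarrow> \<tau> \<in> K))"

definition faces :: "int \<Rightarrow> 'a set set \<Rightarrow> 'a set set"
  where "faces p K = {\<sigma> \<in> K. int (card \<sigma>) = p + 1}"

definition simplicial_chain_group :: "int \<Rightarrow> 'a set set \<Rightarrow> ('a set \<Rightarrow>\<^sub>0 int) monoid"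
  where "simplicial_chain_group p K = free_Abelian_group (faces p K)"

text \<open>
  If the elements of a face are listed in increasing order starting from index 0, then the
  exponent is the index of \<open>v\<close>; this is the usual alternating sum over the
  vertices deleted.
\<close>

definition simplicial_boundary :: "('a::linorder set \<Rightarrow>\<^sub>0 int) \<Rightarrow> ('a set \<Rightarrow>\<^sub>0 int)"
  where "simplicial_boundary =
    frag_extend (\<lambda>\<sigma>. \<Sum>v\<in>\<sigma>. frag_cmul ((-1) ^ card {u \<in> \<sigma>. u < v}) (frag_of (\<sigma> - {v})))"

definition simplicial_cycles :: "int \<Rightarrow> 'a::linorder set set \<Rightarrow> ('a set \<Rightarrow>\<^sub>0 int) set"
  where "simplicial_cycles p K =
    {c \<in> carrier (simplicial_chain_group p K). simplicial_boundary c = 0}"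

definition simplicial_boundaries :: "int \<Rightarrow> 'a::linorder set set \<Rightarrow> ('a set \<Rightarrow>\<^sub>0 int) set"
  where "simplicial_boundaries p K =
    simplicial_boundary ` carrier (simplicial_chain_group (p + 1) K)"

definition reduced_simplicial_homology ::
    "int \<Rightarrow> 'a::linorder set set \<Rightarrow> ('a set \<Rightarrow>\<^sub>0 int) set monoid"
  where "reduced_simplicial_homology p K =
    subgroup_generated (simplicial_chain_group p K) (simplicial_cycles p K)
      Mod simplicial_boundaries p K"


section \<open>Chessboard complexes\<close>

text \<open>
  \<open>Edge i j\<close> is the edge of a complete bipartite graph joining the vertex \<open>i\<close> of the
  first part to the vertex \<open>j\<close> of the second one; the two parts are made disjoint by
  \<open>Inl\<close> and \<open>Inr\<close>. Edges are ordered lexicographically. A datatype is used instead of pairs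
  because the library has two incompatible orders on pairs.
\<close>

datatype edge = Edge nat nat

fun edge_ends :: "edge \<Rightarrow> (nat + nat) set"
  where "edge_ends (Edge i j) = {Inl i, Inr j}"

instantiation edge :: linorder
begin

fun less_eq_edge :: "edge \<Rightarrow> edge \<Rightarrow> bool"
  where "less_eq_edge (Edge i j) (Edge k l) \<longleftrightarrow> i < k \<or> i = k \<and> j \<le> l"

definition less_edge :: "edge \<Rightarrow> edge \<Rightarrow> bool"
  where "less_edge e f \<longleftrightarrow> e \<le> f \<and> \<not> f \<le> e"

instance
proof
  fix x y z :: edge
  show "(x < y) = (x \<le> y \<and> \<not> y \<le> x)" by (rule less_edge_def)
  show "x \<le> x" by (cases x) simp
  show "x \<le> z" if "x \<le> y" "y \<le> z" using that by (cases x; cases y; cases z) auto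
  show "x = y" if "x \<le> y" "y \<le> x" using that by (cases x; cases y) auto
  show "x \<le> y \<or> y \<le> x" by (cases x; cases y) auto
qed

end

definition complete_bipartite_edges :: "nat \<Rightarrow> nat \<Rightarrow> edge set"
  where "complete_bipartite_edges m n = {Edge i j |i j. i \<in> {1..m} \<and> j \<in> {1..n}}"

definition matching :: "edge set \<Rightarrow> bool"
  where "matching M \<longleftrightarrow> pairwise (\<lambda>e f. disjnt (edge_ends e) (edge_ends f)) M"

definition chessboard_complex :: "nat \<Rightarrow> nat \<Rightarrow> edge set set"
  where "chessboard_complex m n = {M. M \<subseteq> complete_bipartite_edges m n \<and> matching M}"


section \<open>The homology groups are well defined\<close>

lemma complex_chessboard_complex: "abstract_simplicial_complex (chessboard_complex m n)"
proof -
  have "complete_bipartite_edges m n = (\<lambda>(i, j). Edge i j) ` ({1..m} \<times> {1..n})"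
    by (auto simp: complete_bipartite_edges_def)
  then have "finite (complete_bipartite_edges m n)" by simp
  then show ?thesis
    by (auto simp: abstract_simplicial_complex_def chessboard_complex_def matching_def
        intro: finite_subset pairwise_subset)
qed

lemma simplicial_boundary_closed:
  assumes K: "abstract_simplicial_complex K"
    and c: "c \<in> carrier (simplicial_chain_group p K)"
  shows "simplicial_boundary c \<in> carrier (simplicial_chain_group (p - 1) K)"
proof -
  have "Poly_Mapping.keys
      (\<Sum>v\<in>\<sigma>. frag_cmul ((-1) ^ card {u \<in> \<sigma>. u < v}) (frag_of (\<sigma> - {v}))) \<subseteq> faces (p - 1) K"
    if "\<sigma> \<in> faces p K" for \<sigma>
  proof -
    have \<sigma>: "\<sigma> \<in> K" "int (card \<sigma>) = p + 1" "finite \<sigma>"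
      using that K by (auto simp: faces_def abstract_simplicial_complex_def)
    have "\<sigma> - {v} \<in> faces (p - 1) K" if "v \<in> \<sigma>" for v
    proof -
      have "card \<sigma> > 0" using \<sigma> that card_gt_0_iff by blast
      then have "int (card (\<sigma> - {v})) = p" using \<sigma> that by (simp add: of_nat_diff)
      moreover have "\<sigma> - {v} \<in> K"
        using K \<sigma> unfolding abstract_simplicial_complex_def by blast
      ultimately show ?thesis by (simp add: faces_def)
    qed
    then show ?thesis
      by (intro order_trans [OF keys_sum] UN_least order_trans [OF keys_cmul]) auto
  qed
  then show ?thesis
    using c unfolding simplicial_boundary_def simplicial_chain_group_def
    by (auto dest!: subsetD [OF keys_frag_extend])
qed

lemma simplicial_boundary_boundary_frag_of:
  fixes \<sigma> :: "'a::linorder set"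
  assumes "finite \<sigma>"
  shows "simplicial_boundary (simplicial_boundary (frag_of \<sigma>)) = 0"
proof -
  define s :: "'a \<Rightarrow> 'a set \<Rightarrow> int" where "s v \<tau> = (-1) ^ card {u \<in> \<tau>. u < v}" for v \<tau>
  define g where "g v w = frag_cmul (s v \<sigma> * s w (\<sigma> - {v})) (frag_of (\<sigma> - {v} - {w}))" for v w
  let ?P = "Sigma \<sigma> (\<lambda>v. \<sigma> - {v})"
  have swap: "g w v = - g v w" if vw: "v \<in> \<sigma>" "w \<in> \<sigma>" "v < w" for v w
  proof -
    have "{u \<in> \<sigma> - {w}. u < v} = {u \<in> \<sigma>. u < v}" using vw by auto
    then have 1: "s v (\<sigma> - {w}) = s v \<sigma>" by (simp add: s_def)
    have "{u \<in> \<sigma>. u < w} = insert v {u \<in> \<sigma> - {v}. u < w}" using vw by auto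
    then have "card {u \<in> \<sigma>. u < w} = Suc (card {u \<in> \<sigma> - {v}. u < w})" using assms by simp
    then have 2: "s w \<sigma> = - s w (\<sigma> - {v})" by (simp add: s_def)
    have "\<sigma> - {w} - {v} = \<sigma> - {v} - {w}" by auto
    then show ?thesis by (simp add: g_def 1 2 mult.commute)
  qed
  have swap': "g w v = - g v w" if "v \<in> \<sigma>" "w \<in> \<sigma>" "v \<noteq> w" for v w
    using that swap [of v w] swap [of w v] by (cases "v < w") auto
  have "simplicial_boundary (simplicial_boundary (frag_of \<sigma>)) = (\<Sum>v\<in>\<sigma>. \<Sum>w\<in>\<sigma> - {v}. g v w)"
    using assms by (simp add: simplicial_boundary_def frag_extend_sum frag_extend_cmul
        frag_cmul_sum g_def s_def)
  also have "\<dots> = (\<Sum>(v, w)\<in>?P. g v w)"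
    using assms by (simp add: sum.Sigma)
  finally have S: "simplicial_boundary (simplicial_boundary (frag_of \<sigma>)) = (\<Sum>(v, w)\<in>?P. g v w)" .
  have "(\<Sum>(v, w)\<in>?P. g v w) = (\<Sum>(v, w)\<in>?P. g w v)"
    by (rule sum.reindex_bij_witness [of _ prod.swap prod.swap]) auto
  also have "\<dots> = (\<Sum>(v, w)\<in>?P. - g v w)"
  proof (rule sum.cong [OF refl])
    fix x assume "x \<in> ?P"
    then obtain v w where "x = (v, w)" "v \<in> \<sigma>" "w \<in> \<sigma>" "v \<noteq> w" by blast
    then show "(case x of (v, w) \<Rightarrow> g w v) = (case x of (v, w) \<Rightarrow> - g v w)"
      by (simp only: prod.case) (rule swap')
  qed
  also have "\<dots> = - (\<Sum>(v, w)\<in>?P. g v w)"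
    by (simp add: sum_negf case_prod_beta)
  finally have "(\<Sum>(v, w)\<in>?P. g v w) = - (\<Sum>(v, w)\<in>?P. g v w)" .
  moreover have "c = 0" if "c = - c" for c :: "'a set \<Rightarrow>\<^sub>0 int"
  proof (rule poly_mapping_eqI)
    fix x
    have "Poly_Mapping.lookup c x = - Poly_Mapping.lookup c x"
      using arg_cong [OF that, of "\<lambda>c. Poly_Mapping.lookup c x"] by simp
    then show "Poly_Mapping.lookup c x = Poly_Mapping.lookup 0 x" by simp
  qed
  ultimately have "(\<Sum>(v, w)\<in>?P. g v w) = 0" by blast
  then show ?thesis by (simp add: S)
qed

lemma simplicial_boundary_boundary:
  assumes K: "abstract_simplicial_complex K"
    and "c \<in> carrier (simplicial_chain_group p K)"
  shows "simplicial_boundary (simplicial_boundary c) = 0"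
proof -
  have "Poly_Mapping.keys c \<subseteq> {\<sigma>. finite \<sigma>}"
    using assms by (auto simp: simplicial_chain_group_def faces_def abstract_simplicial_complex_def)
  then show ?thesis
  proof (induction c rule: frag_induction)
    case zero
    then show ?case by (simp add: simplicial_boundary_def)
  next
    case (one x)
    then show ?case by (simp add: simplicial_boundary_boundary_frag_of)
  next
    case (diff a b)
    then show ?case by (simp add: simplicial_boundary_def frag_extend_diff)
  qed
qed

lemma subgroup_simplicial_cycles:
  "subgroup (simplicial_cycles p K) (simplicial_chain_group p K)"
proof (rule group.subgroupI)
  show "group (simplicial_chain_group p K)" by (simp add: simplicial_chain_group_def)
  have "0 \<in> simplicial_cycles p K"
    by (simp add: simplicial_cycles_def simplicial_chain_group_def simplicial_boundary_def)
  then show "simplicial_cycles p K \<noteq> {}" by blast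
qed (auto simp: simplicial_cycles_def simplicial_chain_group_def simplicial_boundary_def
    frag_extend_add frag_extend_minus dest: subsetD [OF keys_add])

lemma carrier_simplicial_cycle_group:
  "carrier (subgroup_generated (simplicial_chain_group p K) (simplicial_cycles p K))
     = simplicial_cycles p K"
  by (rule subgroup.carrier_subgroup_generated_subgroup [OF subgroup_simplicial_cycles])

theorem comm_group_reduced_simplicial_homology:
  assumes K: "abstract_simplicial_complex K"
  shows "comm_group (reduced_simplicial_homology p K)"
proof -
  let ?Z = "subgroup_generated (simplicial_chain_group p K) (simplicial_cycles p K)"
  have C: "comm_group (simplicial_chain_group p K)" "group (simplicial_chain_group p K)"
    by (simp_all add: simplicial_chain_group_def abelian_free_Abelian_group)
  have Z: "comm_group ?Z"
    using C by (simp add: group.abelian_subgroup_generated)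
  have "subgroup (simplicial_boundaries p K) ?Z"
  proof (rule group.subgroupI)
    show "group ?Z" using Z by (simp add: comm_group_def)
    show sub: "simplicial_boundaries p K \<subseteq> carrier ?Z"
      using simplicial_boundary_closed [OF K, where p = "p + 1"]
        simplicial_boundary_boundary [OF K, where p = "p + 1"]
      unfolding carrier_simplicial_cycle_group
      by (auto simp: simplicial_boundaries_def simplicial_cycles_def)
    have "0 \<in> carrier (simplicial_chain_group (p + 1) K)"
      by (simp add: simplicial_chain_group_def)
    then show "simplicial_boundaries p K \<noteq> {}"
      unfolding simplicial_boundaries_def by blast
    fix a b assume ab: "a \<in> simplicial_boundaries p K" "b \<in> simplicial_boundaries p K"
    then obtain x y where xy: "Poly_Mapping.keys x \<subseteq> faces (p + 1) K"
      "Poly_Mapping.keys y \<subseteq> faces (p + 1) K" "a = simplicial_boundary x" "b = simplicial_boundary y"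
      by (auto simp: simplicial_boundaries_def simplicial_chain_group_def)
    have "a + b = simplicial_boundary (x + y)" "- a = simplicial_boundary (- x)"
      by (simp_all add: xy simplicial_boundary_def frag_extend_add frag_extend_minus)
    moreover have "Poly_Mapping.keys (x + y) \<subseteq> faces (p + 1) K" "Poly_Mapping.keys (- x) \<subseteq> faces (p + 1) K"
      using xy by (auto dest: subsetD [OF keys_add])
    ultimately have cl: "a + b \<in> simplicial_boundaries p K" "- a \<in> simplicial_boundaries p K"
      by (auto simp: simplicial_boundaries_def simplicial_chain_group_def)
    show "a \<otimes>\<^bsub>?Z\<^esub> b \<in> simplicial_boundaries p K"
      using cl by (simp add: simplicial_chain_group_def)
    have "a \<in> carrier ?Z" "- a \<in> carrier ?Z" using sub ab cl by auto
    then have "inv\<^bsub>?Z\<^esub> a = - a"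
      by (intro group.inv_equality [OF \<open>group ?Z\<close>]) (simp_all add: simplicial_chain_group_def)
    then show "inv\<^bsub>?Z\<^esub> a \<in> simplicial_boundaries p K" using cl by simp
  qed
  then show ?thesis
    unfolding reduced_simplicial_homology_def by (rule comm_group.abelian_FactGroup [OF Z])
qed

end

theory Submission
  imports Defs "HOL-Library.Numeral_Type"
begin

text \<open>
  Write \<open>ins e\<close> for exterior multiplication by an edge and \<open>zl l\<close> for the product of the
  zero-dimensional cycles \<open>ab - bc\<close> over the consecutive triples \<open>a, b, c\<close> of a vertex list.

  Nonvanishing: the chessboard complex on \<open>3k + 1\<close> vertices sits inside the matching complex of
  the complete graph on these vertices. There every cycle with \<open>k\<close> edges is homologous to a
  combination of products \<open>zl l\<close>, and induction on \<open>k\<close> yields a functional on cycles, with values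
  modulo 3, that kills boundaries and sends \<open>zl l\<close> to the sign of the list \<open>l\<close>.

  Torsion: on a \<open>5 \<times> 5\<close> board let \<open>h(a, b)\<close> be the product of the triangle with one row and the
  columns \<open>a, b\<close> and of two triangles with two rows and one column each. Up to boundaries and signs
  it depends on \<open>{a, b}\<close> only, since columns may be exchanged with the free one, and it satisfies
  \<open>h(a, b) + h(b, c) + h(c, a) = 0\<close>. Hence \<open>2 h(a, b) = 2 h(c, d)\<close> and \<open>6 h(a, b) = 0\<close>.

  Multiplying with further triangles and with the fundamental cycle of a board with one excess
  column fills up all required boards. Contracting edges of the fundamental cycle reduces the
  nonvanishing of twice this product to the first step.
\<close>


section \<open>Exterior multiplication and contraction of chains\<close>

text \<open>Four vertices show why the prime is 3: the matching complex is then three disjoint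
  segments, and a functional on 0-cycles that changes sign under every transposition of vertices
  must number these segments 0, 1, 2 modulo 3 up to sign and a common shift; over the integers it
  would vanish. The test takes place in the complete graph because only there may any two vertices
  be transposed or joined by an edge; a chain filling a cycle on the board still fills it there. The
  count \<open>3 * k + 1\<close> is critical: on \<open>3 * k + 2\<close> vertices every cycle with
  \<open>k\<close> edges bounds.

  The relations give only that \<open>frag_cmul 6 Z\<close> bounds. As 2 is invertible modulo 3, the
  functional detects \<open>frag_cmul 2 Z\<close> as well as \<open>Z\<close>, so the class of
  \<open>frag_cmul 2 Z\<close> is the one of order 3. Triangles with one free vertex give
  \<open>s\<close> edges on exactly \<open>3 * s + 1\<close> vertices. A fundamental cycle has
  \<open>k + 1\<close> edges on only \<open>2 * k + 3\<close> vertices, and so reaches the higher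
  degrees.\<close>

definition edge_sign :: "'a::linorder \<Rightarrow> 'a set \<Rightarrow> int"
  where "edge_sign e \<sigma> = (-1) ^ card {u \<in> \<sigma>. u < e}"

definition ins :: "'a::linorder \<Rightarrow> ('a set \<Rightarrow>\<^sub>0 int) \<Rightarrow> ('a set \<Rightarrow>\<^sub>0 int)"
  where "ins e = frag_extend (\<lambda>\<sigma>. if e \<in> \<sigma> then 0 else frag_cmul (edge_sign e \<sigma>) (frag_of (insert e \<sigma>)))"

definition del :: "'a::linorder \<Rightarrow> ('a set \<Rightarrow>\<^sub>0 int) \<Rightarrow> ('a set \<Rightarrow>\<^sub>0 int)"
  where "del e = frag_extend (\<lambda>\<sigma>. if e \<in> \<sigma> then frag_cmul (edge_sign e \<sigma>) (frag_of (\<sigma> - {e})) else 0)"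

abbreviation bd :: "('a::linorder set \<Rightarrow>\<^sub>0 int) \<Rightarrow> ('a set \<Rightarrow>\<^sub>0 int)"
  where "bd \<equiv> simplicial_boundary"

text \<open>Signs are read off \<open>card\<close>, which is 0 on infinite sets, so the
  anticommutation rules below can fail there; they are stated for chains supported on finite
  sets.\<close>

definition fin_chain :: "('a set \<Rightarrow>\<^sub>0 int) \<Rightarrow> bool"
  where "fin_chain c \<longleftrightarrow> Poly_Mapping.keys c \<subseteq> Collect finite"

lemma ins_simps [simp]:
  "ins e 0 = 0" "ins e (- a) = - ins e a" "ins e (frag_cmul k a) = frag_cmul k (ins e a)"
  by (simp_all add: ins_def frag_extend_minus frag_extend_cmul)

lemma ins_add: "ins e (a + b) = ins e a + ins e b"
  by (simp add: ins_def frag_extend_add)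

lemma ins_diff: "ins e (a - b) = ins e a - ins e b"
  by (simp add: ins_def frag_extend_diff)

lemma ins_sum: "ins e (sum f I) = (\<Sum>i\<in>I. ins e (f i))"
  by (induction I rule: infinite_finite_induct) (auto simp: ins_add)

lemma del_simps [simp]:
  "del e 0 = 0" "del e (- a) = - del e a" "del e (frag_cmul k a) = frag_cmul k (del e a)"
  by (simp_all add: del_def frag_extend_minus frag_extend_cmul)

lemma del_add: "del e (a + b) = del e a + del e b"
  by (simp add: del_def frag_extend_add)

lemma del_diff: "del e (a - b) = del e a - del e b"
  by (simp add: del_def frag_extend_diff)

lemma del_sum: "del e (sum f I) = (\<Sum>i\<in>I. del e (f i))"
  by (induction I rule: infinite_finite_induct) (auto simp: del_add)

lemma bd_simps [simp]:
  "bd 0 = 0" "bd (- a) = - bd a" "bd (frag_cmul k a) = frag_cmul k (bd a)"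
  by (simp_all add: simplicial_boundary_def frag_extend_minus frag_extend_cmul)

lemma bd_add: "bd (a + b) = bd a + bd b"
  by (simp add: simplicial_boundary_def frag_extend_add)

lemma bd_diff: "bd (a - b) = bd a - bd b"
  by (simp add: simplicial_boundary_def frag_extend_diff)

lemma bd_sum: "bd (sum f I) = (\<Sum>i\<in>I. bd (f i))"
  by (induction I rule: infinite_finite_induct) (auto simp: bd_add)

lemmas linear_simps = ins_add ins_diff ins_sum del_add del_diff del_sum bd_add bd_diff bd_sum

lemma frag_cmul_diff_distrib2: "frag_cmul k (a - b) = frag_cmul k a - frag_cmul k b"
  using frag_cmul_distrib2 [of k a "- b"] frag_cmul_cmul [of k "-1" b] by simp

lemma bd_frag_of: "bd (frag_of \<sigma>) = (\<Sum>v\<in>\<sigma>. del v (frag_of \<sigma>))"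
  by (auto simp: simplicial_boundary_def del_def edge_sign_def intro: sum.cong)

lemma bd_empty [simp]: "bd (frag_of {}) = 0"
  by (simp add: bd_frag_of)

lemma fin_chain_simps [simp]:
  "fin_chain 0" "fin_chain (- a) = fin_chain a" "fin_chain (frag_of \<sigma>) = finite \<sigma>"
  by (simp_all add: fin_chain_def)

lemma fin_chain_cmul [simp]: "fin_chain a \<Longrightarrow> fin_chain (frag_cmul k a)"
  using keys_cmul [of k a] by (auto simp: fin_chain_def)

lemma fin_chain_add [simp]: "fin_chain a \<Longrightarrow> fin_chain b \<Longrightarrow> fin_chain (a + b)"
  using keys_add [of a b] by (auto simp: fin_chain_def)

lemma fin_chain_diff [simp]: "fin_chain a \<Longrightarrow> fin_chain b \<Longrightarrow> fin_chain (a - b)"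
  using keys_diff [of a b] by (auto simp: fin_chain_def)

lemma fin_chain_sum [simp]: "(\<And>i. i \<in> I \<Longrightarrow> fin_chain (f i)) \<Longrightarrow> fin_chain (sum f I)"
  by (induction I rule: infinite_finite_induct) auto

lemma fin_chain_induct [consumes 1, case_names zero one diff]:
  assumes "fin_chain c" "P 0" "\<And>\<sigma>. finite \<sigma> \<Longrightarrow> P (frag_of \<sigma>)"
    and "\<And>a b. fin_chain a \<Longrightarrow> fin_chain b \<Longrightarrow> P a \<Longrightarrow> P b \<Longrightarrow> P (a - b)"
  shows "P c"
proof -
  have "fin_chain c \<and> P c"
    using assms(1) unfolding fin_chain_def
    by (induction c rule: frag_induction)
      (use assms(2-) in \<open>auto simp: fin_chain_def dest: subsetD [OF keys_diff]\<close>)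
  then show ?thesis by simp
qed

lemma fin_chain_ops [simp]:
  assumes "fin_chain c"
  shows "fin_chain (ins e c)" "fin_chain (del e c)" "fin_chain (bd c)"
proof -
  show 1: "fin_chain (ins e c)" 
    using assms by (induction c rule: fin_chain_induct) (auto simp: linear_simps ins_def [of e] frag_extend_diff)
  have 2: "fin_chain (del v c)" for v
    using assms by (induction c rule: fin_chain_induct) (auto simp: linear_simps del_def [of v] frag_extend_diff)
  then show "fin_chain (del e c)" .
  have "fin_chain (del v (frag_of \<sigma>))" if "finite \<sigma>" for v and \<sigma> :: "'a set"
    using that by (simp add: del_def)
  with assms show "fin_chain (bd c)"
    by (induction c rule: fin_chain_induct) (auto simp: linear_simps bd_frag_of)
qed

section \<open>Anticommutation of multiplication, contraction and boundary\<close>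

lemma edge_sign_insert:
  assumes "finite \<sigma>" "f \<notin> \<sigma>"
  shows "edge_sign e (insert f \<sigma>) = (if f < e then -1 else 1) * edge_sign e \<sigma>"
proof (cases "f < e")
  case True
  then have "{u \<in> insert f \<sigma>. u < e} = insert f {u \<in> \<sigma>. u < e}" by auto
  with assms True show ?thesis by (simp add: edge_sign_def)
next
  case False
  then have "{u \<in> insert f \<sigma>. u < e} = {u \<in> \<sigma>. u < e}" by auto
  with False show ?thesis by (simp add: edge_sign_def)
qed

lemma edge_sign_self_insert [simp]: "edge_sign e (insert e \<sigma>) = edge_sign e \<sigma>"
proof -
  have "{u. (u = e \<or> u \<in> \<sigma>) \<and> u < e} = {u \<in> \<sigma>. u < e}" by auto
  then show ?thesis by (simp add: edge_sign_def)
qed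

lemma edge_sign_square [simp]: "edge_sign e \<sigma> * edge_sign e \<sigma> = 1"
  by (simp add: edge_sign_def flip: power_add)

lemma edge_sign_square' [simp]: "edge_sign e \<sigma> * (edge_sign e \<sigma> * k) = k"
  by (simp flip: mult.assoc)

lemma ins_frag_of: "ins e (frag_of \<sigma>) = (if e \<in> \<sigma> then 0 else frag_cmul (edge_sign e \<sigma>) (frag_of (insert e \<sigma>)))"
  by (simp add: ins_def)

lemma del_frag_of: "del e (frag_of \<sigma>) = (if e \<in> \<sigma> then frag_cmul (edge_sign e \<sigma>) (frag_of (\<sigma> - {e})) else 0)"
  by (simp add: del_def)

lemma del_empty [simp]: "del e (frag_of {}) = 0"
  by (simp add: del_frag_of)

lemma del_insert: "e \<notin> \<sigma> \<Longrightarrow> del e (frag_of (insert e \<sigma>)) = frag_cmul (edge_sign e \<sigma>) (frag_of \<sigma>)"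
  by (simp add: del_frag_of)

text \<open>Canonical anticommutation relation: on a basis set exactly one of the two orders of
  \<open>ins e\<close> and \<open>del e\<close> survives, according to whether the set contains
  \<open>e\<close>, and its two signs cancel.\<close>

lemma del_ins_same: "fin_chain c \<Longrightarrow> del e (ins e c) = c - ins e (del e c)"
proof (induction c rule: fin_chain_induct)
  case (one \<sigma>)
  show ?case
  proof (cases "e \<in> \<sigma>")
    case True
    then obtain \<tau> where "\<sigma> = insert e \<tau>" "e \<notin> \<tau>" by (meson mk_disjoint_insert)
    then show ?thesis by (simp add: ins_frag_of del_insert)
  next
    case False
    then show ?thesis by (simp add: ins_frag_of del_insert) (simp add: del_frag_of)
  qed
qed (auto simp: linear_simps)

lemma del_ins:
  assumes ef: "e \<noteq> f" and "fin_chain c"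
  shows "del e (ins f c) = - ins f (del e c)"
  using assms(2)
proof (induction c rule: fin_chain_induct)
  case (one \<sigma>)
  show ?case
  proof (cases "e \<in> \<sigma> \<and> f \<notin> \<sigma>")
    case True
    then obtain \<tau> where \<tau>: "\<sigma> = insert e \<tau>" "e \<notin> \<tau>" by (meson mk_disjoint_insert)
    have "ins f (frag_of (insert e \<tau>)) = frag_cmul (edge_sign f (insert e \<tau>)) (frag_of (insert e (insert f \<tau>)))"
      using \<tau> True by (simp add: ins_frag_of insert_commute)
    moreover have \<tau>': "e \<notin> insert f \<tau>" "f \<notin> \<tau>" "finite \<tau>" using \<tau> ef True one by auto
    ultimately have "del e (ins f (frag_of (insert e \<tau>)))
        = frag_cmul (edge_sign f (insert e \<tau>) * edge_sign e (insert f \<tau>)) (frag_of (insert f \<tau>))"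
      by (simp only: del_insert [OF \<tau>'(1)] del_simps frag_cmul_cmul)
    moreover have "ins f (del e (frag_of (insert e \<tau>))) = frag_cmul (edge_sign e \<tau> * edge_sign f \<tau>) (frag_of (insert f \<tau>))"
      using \<tau>'(2) by (simp only: del_insert [OF \<tau>(2)] ins_simps ins_frag_of frag_cmul_cmul if_False)
    moreover have "edge_sign f (insert e \<tau>) * edge_sign e (insert f \<tau>) = - (edge_sign e \<tau> * edge_sign f \<tau>)"
      using ef by (auto simp: edge_sign_insert [OF \<tau>'(3,2)] edge_sign_insert [OF \<tau>'(3) \<tau>(2)])
    ultimately show ?thesis
      unfolding \<tau>(1) by (simp only: minus_frag_cmul)
  next
    case False
    with one ef show ?thesis by (auto simp: ins_frag_of del_frag_of)
  qed
qed (auto simp: linear_simps)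

lemma ins_ins_same [simp]: "ins e (ins e c) = 0"
proof -
  have "Poly_Mapping.keys c \<subseteq> UNIV" by simp
  then show ?thesis
    by (induction c rule: frag_induction) (auto simp: linear_simps ins_frag_of)
qed

lemma ins_ins: "fin_chain c \<Longrightarrow> ins e (ins f c) = - ins f (ins e c)"
proof (induction c rule: fin_chain_induct)
  case (one \<sigma>)
  show ?case
  proof (cases "e = f \<or> e \<in> \<sigma> \<or> f \<in> \<sigma>")
    case False
    have *: "ins e (ins f (frag_of \<sigma>))
        = frag_cmul (edge_sign f \<sigma> * edge_sign e (insert f \<sigma>)) (frag_of (insert e (insert f \<sigma>)))"
      "ins f (ins e (frag_of \<sigma>))
        = frag_cmul (edge_sign e \<sigma> * edge_sign f (insert e \<sigma>)) (frag_of (insert e (insert f \<sigma>)))"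
      using False by (auto simp: ins_frag_of insert_commute [of f e])
    have "edge_sign f \<sigma> * edge_sign e (insert f \<sigma>) = - (edge_sign e \<sigma> * edge_sign f (insert e \<sigma>))"
    proof -
      have f: "finite \<sigma>" "e \<notin> \<sigma>" "f \<notin> \<sigma>" using False one by auto
      show ?thesis
        using False by (auto simp: edge_sign_insert [OF f(1,2)] edge_sign_insert [OF f(1,3)])
    qed
    then show ?thesis
      unfolding * by (simp only: minus_frag_cmul)
  qed (auto simp: ins_frag_of)
qed (auto simp: linear_simps)

lemma del_del_same [simp]: "del e (del e c) = 0"
proof -
  have "Poly_Mapping.keys c \<subseteq> UNIV" by simp
  then show ?thesis
    by (induction c rule: frag_induction) (auto simp: linear_simps del_frag_of)
qed

lemma del_del: "fin_chain c \<Longrightarrow> del e (del f c) = - del f (del e c)"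
proof (induction c rule: fin_chain_induct)
  case (one \<sigma>)
  show ?case
  proof (cases "e \<in> \<sigma> \<and> f \<in> \<sigma> \<and> e \<noteq> f")
    case True
    define \<tau> where "\<tau> = \<sigma> - {e, f}"
    have \<tau>: "\<sigma> = insert e (insert f \<tau>)" "\<sigma> = insert f (insert e \<tau>)" "e \<notin> \<tau>" "f \<notin> \<tau>" "finite \<tau>"
      using True one by (auto simp: \<tau>_def)
    have *: "e \<notin> insert f \<tau>" "f \<notin> insert e \<tau>" using True \<tau> by auto
    have "edge_sign f (insert e \<tau>) * edge_sign e \<tau> = - (edge_sign e (insert f \<tau>) * edge_sign f \<tau>)"
      using True by (auto simp: edge_sign_insert [OF \<tau>(5,3)] edge_sign_insert [OF \<tau>(5,4)])
    moreover have "del e (del f (frag_of \<sigma>)) = frag_cmul (edge_sign f (insert e \<tau>) * edge_sign e \<tau>) (frag_of \<tau>)"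
      unfolding \<tau>(2) by (simp only: del_insert [OF *(2)] del_insert [OF \<tau>(3)] del_simps frag_cmul_cmul)
    moreover have "del f (del e (frag_of \<sigma>)) = frag_cmul (edge_sign e (insert f \<tau>) * edge_sign f \<tau>) (frag_of \<tau>)"
      unfolding \<tau>(1) by (simp only: del_insert [OF *(1)] del_insert [OF \<tau>(4)] del_simps frag_cmul_cmul)
    ultimately show ?thesis by (simp only: minus_frag_cmul)
  next
    case False
    then show ?thesis by (cases "e = f") (auto simp: del_frag_of)
  qed
qed (auto simp: linear_simps)

text \<open>The boundary is the sum of all contractions, and contractions anticommute. Hence
  contracting by an edge takes cycles to cycles and boundaries to boundaries on the remaining
  vertices; the inductions below rest on this link map.\<close>

lemma del_bd: "fin_chain c \<Longrightarrow> del e (bd c) = - bd (del e c)"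
proof (induction c rule: fin_chain_induct)
  case (one \<sigma>)
  show ?case
  proof (cases "e \<in> \<sigma>")
    case True
    then obtain \<tau> where \<tau>: "\<sigma> = insert e \<tau>" "e \<notin> \<tau>" by (meson mk_disjoint_insert)
    with one have f: "finite \<tau>" by simp
    have "del e (bd (frag_of \<sigma>)) = (\<Sum>v\<in>\<tau>. del e (del v (frag_of \<sigma>)))"
      using \<tau> f by (simp add: bd_frag_of linear_simps)
    also have "\<dots> = (\<Sum>v\<in>\<tau>. - del v (del e (frag_of \<sigma>)))"
      using one by (intro sum.cong refl del_del) auto
    also have "\<dots> = - bd (del e (frag_of \<sigma>))"
      using \<tau> by (simp add: del_insert bd_frag_of frag_cmul_sum flip: sum_negf)
    finally show ?thesis .
  next
    case False
    have "del e (del v (frag_of \<sigma>)) = 0" for v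
      using False by (auto simp: del_frag_of)
    then show ?thesis
      using False by (simp add: bd_frag_of linear_simps) (simp add: del_frag_of)
  qed
qed (auto simp: linear_simps)

text \<open>\<open>ins e\<close> is the contracting homotopy given by the cone with apex
  \<open>e\<close>: a cycle bounds as soon as multiplication by some edge keeps it among the
  matching chains.\<close>

lemma bd_ins: "fin_chain c \<Longrightarrow> bd (ins e c) = c - ins e (bd c)"
proof (induction c rule: fin_chain_induct)
  case (one \<sigma>)
  show ?case
  proof (cases "e \<in> \<sigma>")
    case True
    then obtain \<tau> where \<tau>: "\<sigma> = insert e \<tau>" "e \<notin> \<tau>" by (meson mk_disjoint_insert)
    with one have f: "finite \<tau>" by simp
    have "ins e (del v (frag_of \<sigma>)) = 0" if "v \<in> \<tau>" for v
      using that \<tau> by (auto simp: del_frag_of ins_frag_of)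
    then have "ins e (bd (frag_of \<sigma>)) = ins e (del e (frag_of \<sigma>))"
      using \<tau> f by (simp add: bd_frag_of linear_simps)
    also have "\<dots> = frag_of \<sigma>" using \<tau> by (simp add: del_insert ins_frag_of)
    finally show ?thesis using True by (simp add: ins_frag_of)
  next
    case False
    have "bd (ins e (frag_of \<sigma>)) = (\<Sum>v\<in>insert e \<sigma>. del v (ins e (frag_of \<sigma>)))"
      using False by (simp add: ins_frag_of bd_frag_of frag_cmul_sum)
    also have "\<dots> = del e (ins e (frag_of \<sigma>)) + (\<Sum>v\<in>\<sigma>. del v (ins e (frag_of \<sigma>)))"
      using False one by simp
    also have "(\<Sum>v\<in>\<sigma>. del v (ins e (frag_of \<sigma>))) = (\<Sum>v\<in>\<sigma>. - ins e (del v (frag_of \<sigma>)))"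
      using False one by (intro sum.cong refl del_ins) auto
    also have "\<dots> = - ins e (bd (frag_of \<sigma>))"
      by (simp add: bd_frag_of linear_simps sum_negf)
    also have "del e (ins e (frag_of \<sigma>)) = frag_of \<sigma>"
      using False one by (simp add: del_ins_same) (simp add: del_frag_of)
    finally show ?thesis by simp
  qed
qed (auto simp: linear_simps)

lemma bd_bd: "fin_chain c \<Longrightarrow> bd (bd c) = 0"
  by (induction c rule: fin_chain_induct)
    (auto simp: linear_simps simplicial_boundary_boundary_frag_of)

section \<open>Matching chains of a graph\<close>

locale simple_graph =
  fixes adj :: "'v \<Rightarrow> 'v \<Rightarrow> bool" and ed :: "'v \<Rightarrow> 'v \<Rightarrow> 'e::linorder" and ends :: "'e \<Rightarrow> 'v set"
  assumes adj_sym: "adj a b \<Longrightarrow> adj b a"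
    and adj_irrefl: "adj a b \<Longrightarrow> a \<noteq> b"
    and ed_commute: "adj a b \<Longrightarrow> ed a b = ed b a"
    and ends_ed [simp]: "adj a b \<Longrightarrow> ends (ed a b) = {a, b}"
begin

definition edges :: "'e set"
  where "edges = {ed a b |a b. adj a b}"

definition matchings :: "nat \<Rightarrow> 'v set \<Rightarrow> 'e set set"
  where "matchings s V = {\<sigma>. finite \<sigma> \<and> card \<sigma> = s \<and> \<sigma> \<subseteq> edges \<and>
    pairwise (\<lambda>e f. disjnt (ends e) (ends f)) \<sigma> \<and> (\<forall>e\<in>\<sigma>. ends e \<subseteq> V)}"

definition ch :: "nat \<Rightarrow> 'v set \<Rightarrow> ('e set \<Rightarrow>\<^sub>0 int) set"
  where "ch s V = {c. Poly_Mapping.keys c \<subseteq> matchings s V}"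

definition cyc :: "nat \<Rightarrow> 'v set \<Rightarrow> ('e set \<Rightarrow>\<^sub>0 int) set"
  where "cyc s V = {c \<in> ch s V. bd c = 0}"

definition bdy :: "nat \<Rightarrow> 'v set \<Rightarrow> ('e set \<Rightarrow>\<^sub>0 int) set"
  where "bdy s V = bd ` ch (Suc s) V"

lemma edges_iff: "adj a b \<Longrightarrow> ed a b \<in> edges"
  by (auto simp: edges_def)

lemma edgesE:
  assumes "e \<in> edges"
  obtains a b where "adj a b" "e = ed a b" "ends e = {a, b}"
  using assms by (auto simp: edges_def)

lemma ch_0 [simp]: "0 \<in> ch s V"
  by (simp add: ch_def)

lemma ch_frag_of [simp]: "frag_of \<sigma> \<in> ch s V \<longleftrightarrow> \<sigma> \<in> matchings s V"
  by (simp add: ch_def)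

lemma ch_minus [simp]: "- a \<in> ch s V \<longleftrightarrow> a \<in> ch s V"
  by (simp add: ch_def)

lemma ch_add: "a \<in> ch s V \<Longrightarrow> b \<in> ch s V \<Longrightarrow> a + b \<in> ch s V"
  using keys_add [of a b] by (auto simp: ch_def)

lemma ch_diff: "a \<in> ch s V \<Longrightarrow> b \<in> ch s V \<Longrightarrow> a - b \<in> ch s V"
  using keys_diff [of a b] by (auto simp: ch_def)

lemma ch_cmul: "a \<in> ch s V \<Longrightarrow> frag_cmul k a \<in> ch s V"
  using keys_cmul [of k a] by (auto simp: ch_def)

lemma ch_sum: "(\<And>i. i \<in> I \<Longrightarrow> f i \<in> ch s V) \<Longrightarrow> sum f I \<in> ch s V"
  by (induction I rule: infinite_finite_induct) (auto intro: ch_add)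

lemma matchings_mono: "V \<subseteq> W \<Longrightarrow> matchings s V \<subseteq> matchings s W"
  by (auto simp: matchings_def)

lemma ch_mono: "V \<subseteq> W \<Longrightarrow> c \<in> ch s V \<Longrightarrow> c \<in> ch s W"
  using matchings_mono [of V W s] by (auto simp: ch_def)

lemma ch_fin [simp]: "c \<in> ch s V \<Longrightarrow> fin_chain c"
  by (auto simp: ch_def fin_chain_def matchings_def)

lemma ch_induct [consumes 1, case_names zero one diff]:
  assumes "c \<in> ch s V" "P 0" "\<And>\<sigma>. \<sigma> \<in> matchings s V \<Longrightarrow> P (frag_of \<sigma>)"
    and "\<And>a b. a \<in> ch s V \<Longrightarrow> b \<in> ch s V \<Longrightarrow> P a \<Longrightarrow> P b \<Longrightarrow> P (a - b)"
  shows "P c"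
proof -
  have "Poly_Mapping.keys c \<subseteq> matchings s V" using assms(1) by (simp add: ch_def)
  then have "c \<in> ch s V \<and> P c"
    by (induction c rule: frag_induction) (use assms(2-) in \<open>auto intro: ch_diff\<close>)
  then show ?thesis by simp
qed

lemma matchings_insert:
  assumes "\<sigma> \<in> matchings s V" "e \<in> edges" "ends e \<inter> V = {}" "ends e \<union> V \<subseteq> W"
  shows "e \<notin> \<sigma>" "insert e \<sigma> \<in> matchings (Suc s) W"
proof -
  have "ends e \<noteq> {}" using assms(2) by (auto elim: edgesE)
  then show "e \<notin> \<sigma>" using assms(1,3) by (fastforce simp: matchings_def)
  have "disjnt (ends e) (ends f)" "disjnt (ends f) (ends e)" if "f \<in> \<sigma>" for f
  proof -
    have "ends f \<subseteq> V" using that assms(1) by (auto simp: matchings_def)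
    then show "disjnt (ends e) (ends f)" "disjnt (ends f) (ends e)" using assms(3) by (auto simp: disjnt_def)
  qed
  moreover have "ends f \<subseteq> W" if "f \<in> \<sigma>" for f
    using that assms(1,4) by (force simp: matchings_def)
  ultimately show "insert e \<sigma> \<in> matchings (Suc s) W"
    using \<open>e \<notin> \<sigma>\<close> assms by (simp add: matchings_def pairwise_insert)
qed

lemma matchings_remove:
  assumes "\<sigma> \<in> matchings s V" "e \<in> \<sigma>"
  shows "\<sigma> - {e} \<in> matchings (s - 1) (V - ends e)"
proof -
  have "ends f \<subseteq> V - ends e" if "f \<in> \<sigma>" "f \<noteq> e" for f
  proof -
    have "disjnt (ends f) (ends e)" "ends f \<subseteq> V"
      using that assms by (auto simp: matchings_def pairwise_def)
    then show ?thesis by (auto simp: disjnt_def)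
  qed
  then show ?thesis
    using assms by (auto simp: matchings_def intro: pairwise_subset)
qed

lemma ins_ch:
  assumes "c \<in> ch s V" "e \<in> edges" "ends e \<inter> V = {}" "ends e \<union> V \<subseteq> W"
  shows "ins e c \<in> ch (Suc s) W"
  using assms(1)
proof (induction c rule: ch_induct)
  case (one \<sigma>)
  then show ?case
    using matchings_insert [OF one assms(2-)] by (auto simp: ins_frag_of intro: ch_cmul)
qed (auto simp: linear_simps intro: ch_diff)

lemma del_ch:
  assumes "c \<in> ch (Suc s) V"
  shows "del e c \<in> ch s (V - ends e)"
  using assms
proof (induction c rule: ch_induct)
  case (one \<sigma>)
  then show ?case
    using matchings_remove [OF one, of e] by (auto simp: del_frag_of intro: ch_cmul)
qed (auto simp: linear_simps intro: ch_diff)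

lemma del_ch_0:
  assumes "c \<in> ch 0 V"
  shows "del e c = 0"
  using assms by (induction c rule: ch_induct) (auto simp: linear_simps del_frag_of matchings_def)

lemma bd_ch:
  assumes "c \<in> ch (Suc s) V"
  shows "bd c \<in> ch s V"
  using assms
proof (induction c rule: ch_induct)
  case (one \<sigma>)
  have "del v (frag_of \<sigma>) \<in> ch s V" for v
    by (rule ch_mono [OF _ del_ch [where e = v]]) (use one in auto)
  then show ?case by (simp add: bd_frag_of ch_sum)
qed (auto simp: linear_simps intro: ch_diff)

lemma del_outside:
  assumes "c \<in> ch s V" "\<not> ends e \<subseteq> V"
  shows "del e c = 0"
  using assms(1) by (induction c rule: ch_induct) (use assms(2) in \<open>auto simp: linear_simps del_frag_of matchings_def\<close>)

lemma ed_eq_iff: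
  assumes "adj v i" "adj v j"
  shows "ed v i = ed v j \<longleftrightarrow> i = j"
proof
  assume "ed v i = ed v j"
  then have "{v, i} = {v, j}" using ends_ed [OF assms(1)] ends_ed [OF assms(2)] by simp
  then show "i = j" by (auto simp: doubleton_eq_iff)
qed simp

text \<open>A matching has at most one edge at \<open>v\<close>, and \<open>ins e\<close> after
  \<open>del e\<close> projects onto the sets containing \<open>e\<close>; so the sum is precisely
  the part of \<open>c\<close> that meets \<open>v\<close>.\<close>

lemma vertex_split:
  assumes "finite V" "c \<in> ch s V"
  shows "c - (\<Sum>j\<in>{j \<in> V. adj v j}. ins (ed v j) (del (ed v j) c)) \<in> ch s (V - {v})"
  using assms(2)
proof (induction c rule: ch_induct)
  case (one \<sigma>)
  let ?N = "{j \<in> V. adj v j}"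
  have id: "ins e (del e (frag_of \<sigma>)) = (if e \<in> \<sigma> then frag_of \<sigma> else 0)" for e :: 'e
  proof (cases "e \<in> \<sigma>")
    case True
    then obtain \<tau> where "\<sigma> = insert e \<tau>" "e \<notin> \<tau>" by (meson mk_disjoint_insert)
    then show ?thesis by (simp add: del_insert ins_frag_of)
  qed (simp add: del_frag_of)
  show ?case
  proof (cases "\<exists>e\<in>\<sigma>. v \<in> ends e")
    case True
    then obtain e where e: "e \<in> \<sigma>" "v \<in> ends e" by blast
    then have "e \<in> edges" "ends e \<subseteq> V" using one by (auto simp: matchings_def)
    then obtain i where i: "adj v i" "e = ed v i" "i \<in> V"
      using e by (elim edgesE) (auto dest: adj_sym simp: ed_commute)
    have "ed v j \<in> \<sigma> \<longleftrightarrow> j = i" if "j \<in> ?N" for j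
    proof
      assume j: "ed v j \<in> \<sigma>"
      have "\<not> disjnt (ends (ed v j)) (ends e)" using that e by (auto simp: disjnt_def)
      then have "ed v j = e" using j e one by (auto simp: matchings_def pairwise_def)
      then show "j = i" using i that ed_eq_iff by auto
    qed (use e i in auto)
    then have "(\<Sum>j\<in>?N. ins (ed v j) (del (ed v j) (frag_of \<sigma>))) = (\<Sum>j\<in>?N. if j = i then frag_of \<sigma> else 0)"
      by (intro sum.cong) (auto simp: id)
    also have "\<dots> = frag_of \<sigma>" using i assms(1) by (simp add: sum.delta)
    finally show ?thesis by simp
  next
    case False
    then have "(\<Sum>j\<in>?N. ins (ed v j) (del (ed v j) (frag_of \<sigma>))) = 0"
      by (intro sum.neutral) (auto simp: id)
    moreover have "\<sigma> \<in> matchings s (V - {v})" using False one by (auto simp: matchings_def)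
    ultimately show ?thesis by simp
  qed
next
  case (diff a b)
  then show ?case
    using ch_diff [OF diff(3,4)] by (simp add: linear_simps sum_subtractf algebra_simps)
qed auto

lemma cyc_ch: "c \<in> cyc s V \<Longrightarrow> c \<in> ch s V"
  by (simp add: cyc_def)

lemma cyc_bd: "c \<in> cyc s V \<Longrightarrow> bd c = 0"
  by (simp add: cyc_def)

lemma cyc_fin [simp]: "c \<in> cyc s V \<Longrightarrow> fin_chain c"
  by (meson cyc_ch ch_fin)

lemma cyc_0 [simp]: "0 \<in> cyc s V"
  by (simp add: cyc_def)

lemma cyc_minus [simp]: "- a \<in> cyc s V \<longleftrightarrow> a \<in> cyc s V"
  by (simp add: cyc_def)

lemma cyc_add: "a \<in> cyc s V \<Longrightarrow> b \<in> cyc s V \<Longrightarrow> a + b \<in> cyc s V"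
  by (simp add: cyc_def ch_add bd_add)

lemma cyc_diff: "a \<in> cyc s V \<Longrightarrow> b \<in> cyc s V \<Longrightarrow> a - b \<in> cyc s V"
  by (simp add: cyc_def ch_diff bd_diff)

lemma cyc_cmul: "a \<in> cyc s V \<Longrightarrow> frag_cmul k a \<in> cyc s V"
  by (simp add: cyc_def ch_cmul)

lemma cyc_sum: "(\<And>i. i \<in> I \<Longrightarrow> f i \<in> cyc s V) \<Longrightarrow> sum f I \<in> cyc s V"
  by (induction I rule: infinite_finite_induct) (auto intro: cyc_add)

lemma cyc_mono: "V \<subseteq> W \<Longrightarrow> c \<in> cyc s V \<Longrightarrow> c \<in> cyc s W"
  by (auto simp: cyc_def intro: ch_mono)

lemma del_cyc: "c \<in> cyc (Suc s) V \<Longrightarrow> del e c \<in> cyc s (V - ends e)"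
  using del_bd [of c e] by (auto simp: cyc_def intro: del_ch)

lemma bdyI: "y \<in> ch (Suc s) V \<Longrightarrow> bd y \<in> bdy s V"
  by (auto simp: bdy_def)

lemma bdy_cyc: "c \<in> bdy s V \<Longrightarrow> c \<in> cyc s V"
  by (auto simp: bdy_def cyc_def bd_bd bd_ch)

lemma bdy_0 [simp]: "0 \<in> bdy s V"
  by (auto simp: bdy_def intro!: image_eqI [of _ _ 0])

lemma bdy_minus: "a \<in> bdy s V \<Longrightarrow> - a \<in> bdy s V"
  by (auto simp: bdy_def intro!: image_eqI [of _ _ "- y" for y])

lemma bdy_add: "a \<in> bdy s V \<Longrightarrow> b \<in> bdy s V \<Longrightarrow> a + b \<in> bdy s V"
  by (auto simp: bdy_def bd_add [symmetric] intro!: imageI ch_add)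

lemma bdy_diff: "a \<in> bdy s V \<Longrightarrow> b \<in> bdy s V \<Longrightarrow> a - b \<in> bdy s V"
  by (auto simp: bdy_def bd_diff [symmetric] intro!: imageI ch_diff)

lemma bdy_cmul: "a \<in> bdy s V \<Longrightarrow> frag_cmul k a \<in> bdy s V"
  by (auto simp: bdy_def bd_simps(3) [symmetric] simp del: bd_simps intro!: imageI ch_cmul)

lemma bdy_mono: "V \<subseteq> W \<Longrightarrow> c \<in> bdy s V \<Longrightarrow> c \<in> bdy s W"
  by (auto simp: bdy_def intro: ch_mono)

lemma del_bdy: "c \<in> bdy (Suc s) V \<Longrightarrow> del e c \<in> bdy s (V - ends e)"
  by (auto simp: bdy_def del_bd intro!: image_eqI [of _ _ "- del e y" for y] del_ch)

section \<open>Products with zero-dimensional cycles\<close>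

lemma ins_diff_cyc:
  assumes "c \<in> cyc s V" "adj a b" "adj a' b'" "{a, b, a', b'} \<inter> V = {}" "{a, b, a', b'} \<union> V \<subseteq> W"
  shows "ins (ed a b) c - ins (ed a' b') c \<in> cyc (Suc s) W"
proof -
  have "ins (ed a b) c - ins (ed a' b') c \<in> ch (Suc s) W"
    by (intro ch_diff ins_ch [OF cyc_ch [OF assms(1)]] edges_iff) (use assms in auto)
  moreover have "bd (ins (ed a b) c - ins (ed a' b') c) = 0"
    using cyc_fin [OF assms(1)] cyc_bd [OF assms(1)] by (simp add: linear_simps bd_ins)
  ultimately show ?thesis by (simp add: cyc_def)
qed

lemma ins_diff_bdy:
  assumes "c \<in> bdy s V" "adj a b" "adj a' b'" "{a, b, a', b'} \<inter> V = {}" "{a, b, a', b'} \<union> V \<subseteq> W"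
  shows "ins (ed a b) c - ins (ed a' b') c \<in> bdy (Suc s) W"
proof -
  obtain y where y: "y \<in> ch (Suc s) V" "c = bd y" using assms(1) by (auto simp: bdy_def)
  have "ins (ed a b) y - ins (ed a' b') y \<in> ch (Suc (Suc s)) W"
    by (intro ch_diff ins_ch [OF y(1)] edges_iff) (use assms in auto)
  moreover have "ins (ed a b) c - ins (ed a' b') c = - bd (ins (ed a b) y - ins (ed a' b') y)"
    using y ch_fin [OF y(1)] by (simp add: linear_simps bd_ins)
  ultimately show ?thesis using bdyI bdy_minus by metis
qed

text \<open>The two disjoint edges span a segment of the complex, and the product of this segment
  with \<open>c\<close> has the difference as its boundary.\<close>

lemma exchange_bdy:
  assumes "c \<in> cyc s V" "adj a b" "adj a' b'" "{a, b} \<inter> {a', b'} = {}" "{a, b, a', b'} \<inter> V = {}"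
    "{a, b, a', b'} \<union> V \<subseteq> W"
  shows "ins (ed a b) c - ins (ed a' b') c \<in> bdy (Suc s) W"
proof -
  have 1: "ins (ed a b) c \<in> ch (Suc s) ({a, b} \<union> V)"
    by (rule ins_ch [OF cyc_ch [OF assms(1)] edges_iff [OF assms(2)]]) (use assms in auto)
  have "ins (ed a' b') (ins (ed a b) c) \<in> ch (Suc (Suc s)) W"
    by (rule ins_ch [OF 1 edges_iff [OF assms(3)]]) (use assms in auto)
  moreover have "ins (ed a b) c - ins (ed a' b') c = bd (ins (ed a' b') (ins (ed a b) c))"
    using cyc_fin [OF assms(1)] cyc_bd [OF assms(1)] by (simp add: bd_ins linear_simps)
  ultimately show ?thesis using bdyI by metis
qed

text \<open>A remainder of one or two vertices contributes no factor. A list of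
  \<open>3 * k + 1\<close> vertices thus encodes a product of \<open>k\<close> factors together with
  the vertex left free, which matters for the sign of the list.\<close>

fun zl :: "'v list \<Rightarrow> ('e set \<Rightarrow>\<^sub>0 int) \<Rightarrow> ('e set \<Rightarrow>\<^sub>0 int)"
  where "zl (a # b # c # l) x = ins (ed a b) (zl l x) - ins (ed b c) (zl l x)"
  | "zl _ x = x"

fun path_triples :: "'v list \<Rightarrow> bool"
  where "path_triples (a # b # c # l) \<longleftrightarrow> adj a b \<and> adj b c \<and> path_triples l"
  | "path_triples _ \<longleftrightarrow> True"

lemma zl_cyc:
  assumes "x \<in> cyc s W" "path_triples l" "distinct l" "set l \<inter> W = {}" "set l \<union> W \<subseteq> V"
  shows "zl l x \<in> cyc (s + length l div 3) V"
  using assms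
proof (induction l x arbitrary: V rule: zl.induct)
  case (1 a b c l x)
  have "zl l x \<in> cyc (s + length l div 3) (set l \<union> W)"
    by (rule "1.IH") (use "1.prems" in auto)
  then have "zl (a # b # c # l) x \<in> cyc (Suc (s + length l div 3)) V"
    unfolding zl.simps by (rule ins_diff_cyc) (use "1.prems" in auto)
  then show ?case by simp
qed (auto intro: cyc_mono)

lemma zl_diff: "zl l (x - y) = zl l x - zl l y"
  by (induction l x rule: zl.induct) (auto simp: linear_simps)

lemma zl_cmul: "zl l (frag_cmul k x) = frag_cmul k (zl l x)"
  by (induction l x rule: zl.induct) (auto simp: frag_cmul_diff_distrib2)

lemma three_dvd_simps:
  "(3::nat) dvd Suc (Suc (Suc n)) \<longleftrightarrow> 3 dvd n" "\<not> (3::nat) dvd Suc 0" "\<not> (3::nat) dvd Suc (Suc 0)"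
  by presburger+

lemma zl_append: "3 dvd length l \<Longrightarrow> zl (l @ l') x = zl l (zl l' x)"
  by (induction l x rule: zl.induct) (auto simp: three_dvd_simps)

lemma path_triples_append: "3 dvd length l \<Longrightarrow> path_triples (l @ l') \<longleftrightarrow> path_triples l \<and> path_triples l'"
  by (induction l rule: path_triples.induct) (auto simp: three_dvd_simps)

lemma zl_fin [simp]: "fin_chain x \<Longrightarrow> fin_chain (zl l x)"
  by (induction l x rule: zl.induct) auto

lemma zl_ins:
  assumes "fin_chain x"
  shows "zl l (ins e x) = (if even (length l div 3) then ins e (zl l x) else - ins e (zl l x))"
  using assms
proof (induction l x rule: zl.induct)
  case (1 a b c l x)
  then show ?case
    by (simp add: linear_simps ins_ins [of _ e] split: if_splits)
qed (auto simp: linear_simps)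

text \<open>Every factor is an odd operator, so a triple moved past \<open>length xs div 3\<close>
  others picks up that parity, which is also the parity of \<open>length xs\<close>. The sign of the
  list changes in the same way, see \<open>lsgn_front3\<close>.\<close>

lemma zl_front:
  assumes "fin_chain x" "3 dvd length xs"
  shows "zl (xs @ a # b # c # ys) x = (if even (length xs) then zl (a # b # c # xs @ ys) x else - zl (a # b # c # xs @ ys) x)"
proof -
  have "even (length xs) \<longleftrightarrow> even (length xs div 3)" using assms(2) by auto
  then show ?thesis using assms
    by (simp add: zl_append zl_diff zl_ins)
qed

text \<open>An edge with an end outside the list differs from every edge of the product, so its
  contraction anticommutes with each factor.\<close>

lemma del_zl:
  assumes "fin_chain x" "path_triples l" "\<not> ends e \<subseteq> set l"
  shows "del e (zl l x) = (if even (length l div 3) then zl l (del e x) else - zl l (del e x))"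
  using assms
proof (induction l x rule: zl.induct)
  case (1 a b c l x)
  then have "e \<noteq> ed a b" "e \<noteq> ed b c" "\<not> ends e \<subseteq> set l" by auto
  with 1 show ?case
    by (auto simp: linear_simps del_ins)
qed auto

end

lemma two_elements:
  assumes "2 \<le> card A"
  obtains u v where "u \<in> A" "v \<in> A" "u \<noteq> v"
proof -
  have "finite A" using assms by (metis card.infinite not_numeral_le_zero)
  with assms have "\<not> (\<forall>u\<in>A. \<forall>v\<in>A. u = v)" by (simp flip: card_le_Suc0_iff_eq)
  then show ?thesis using that by blast
qed

lemma (in simple_graph) vertex_avoid:
  assumes "finite V" "c \<in> ch s V" "\<And>j. j \<in> V \<Longrightarrow> adj v j \<Longrightarrow> del (ed v j) c = 0"
  shows "c \<in> ch s (V - {v})"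
  using vertex_split [OF assms(1,2), of v] assms(3) by simp

section \<open>Generators of the bottom homology of the matching complex\<close>

locale complete_graph = simple_graph adj ed ends
  for adj :: "'v::linorder \<Rightarrow> 'v \<Rightarrow> bool" and ed :: "'v \<Rightarrow> 'v \<Rightarrow> 'e::linorder" and ends :: "'e \<Rightarrow> 'v set" +
  assumes adj_neq [simp, intro]: "a \<noteq> b \<Longrightarrow> adj a b"
begin

lemma adj_self [simp]: "\<not> adj a a"
  using adj_irrefl by blast

lemma ed_sym: "ed a b = ed b a"
  by (cases "a = b") (auto intro: ed_commute)

lemma ed_neq: "{a, b} \<noteq> {c, d} \<Longrightarrow> a \<noteq> b \<Longrightarrow> c \<noteq> d \<Longrightarrow> ed a b \<noteq> ed c d"
  by (metis adj_neq ends_ed)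

lemma path_triples_distinct: "distinct l \<Longrightarrow> path_triples l"
  by (induction l rule: path_triples.induct) auto

lemma empty_cyc: "frag_of {} \<in> cyc 0 V"
  by (simp add: cyc_def matchings_def)

lemma zl_cyc_empty:
  assumes "distinct l" "set l \<subseteq> V" "length l div 3 = s"
  shows "zl l (frag_of {}) \<in> cyc s V"
proof -
  have "zl l (frag_of {}) \<in> cyc (0 + length l div 3) V"
    by (rule zl_cyc [where W = "{}"]) (use assms in \<open>auto intro: path_triples_distinct empty_cyc\<close>)
  with assms show ?thesis by simp
qed

text \<open>Boundaries are among the generators, so membership is a statement about homology classes
  although it is phrased for chains.\<close>

inductive gen :: "nat \<Rightarrow> 'v set \<Rightarrow> ('e set \<Rightarrow>\<^sub>0 int) \<Rightarrow> bool" for s V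
  where gen_zl: "distinct l \<Longrightarrow> set l \<subseteq> V \<Longrightarrow> length l = 3 * s \<Longrightarrow> gen s V (zl l (frag_of {}))"
  | gen_bdy: "c \<in> bdy s V \<Longrightarrow> gen s V c"
  | gen_add: "gen s V a \<Longrightarrow> gen s V b \<Longrightarrow> gen s V (a + b)"
  | gen_minus: "gen s V a \<Longrightarrow> gen s V (- a)"

lemma gen_0: "gen s V 0"
  by (rule gen_bdy) simp

lemma gen_sum: "(\<And>i. i \<in> I \<Longrightarrow> gen s V (f i)) \<Longrightarrow> gen s V (sum f I)"
  by (induction I rule: infinite_finite_induct) (auto intro: gen_0 gen_add)

lemma gen_cyc: "gen s V c \<Longrightarrow> c \<in> cyc s V"
  by (induction rule: gen.induct) (auto intro: zl_cyc_empty bdy_cyc cyc_add)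

lemma gen_step:
  assumes "gen s V c" "distinct [i, u, v]" "{i, u, v} \<inter> V = {}" "{i, u, v} \<union> V \<subseteq> W"
  shows "gen (Suc s) W (ins (ed i u) c - ins (ed u v) c)"
  using assms(1)
proof (induction rule: gen.induct)
  case (gen_zl l)
  then have "gen (Suc s) W (zl (i # u # v # l) (frag_of {}))"
    by (intro gen.gen_zl) (use assms in auto)
  then show ?case by simp
next
  case (gen_bdy c)
  show ?case
    by (intro gen.gen_bdy ins_diff_bdy [OF gen_bdy]) (use assms in auto)
next
  case (gen_add a b)
  from gen.gen_add [OF gen_add(3,4)] show ?case by (simp add: linear_simps algebra_simps)
next
  case (gen_minus a)
  from gen.gen_minus [OF gen_minus(2)] show ?case by (simp add: linear_simps)
qed

text \<open>A product occupies \<open>3 * s\<close> vertices; an edge between two spare vertices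
  cones it off.\<close>

lemma gen_imp_bdy:
  assumes "gen s V c" "finite V" "3 * s + 2 \<le> card V"
  shows "c \<in> bdy s V"
  using assms(1)
proof (induction rule: gen.induct)
  case (gen_zl l)
  have "card (V - set l) \<ge> 2"
    using assms(2,3) gen_zl by (simp add: card_Diff_subset distinct_card)
  then obtain u v where uv: "u \<in> V - set l" "v \<in> V - set l" "u \<noteq> v"
    by (rule two_elements)
  have c: "zl l (frag_of {}) \<in> cyc s (set l)" by (rule zl_cyc_empty) (use gen_zl in auto)
  then have "ins (ed u v) (zl l (frag_of {})) \<in> ch (Suc s) V"
    by (intro ins_ch [OF cyc_ch] edges_iff) (use uv gen_zl in auto)
  moreover have "bd (ins (ed u v) (zl l (frag_of {}))) = zl l (frag_of {})"
    using cyc_bd [OF c] by (simp add: bd_ins)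
  ultimately show ?case using bdyI by metis
qed (auto intro: bdy_add bdy_minus)

lemma gen_dim_0: "c \<in> ch 0 V \<Longrightarrow> gen 0 V c"
proof (induction c rule: ch_induct)
  case (one \<sigma>)
  then have "\<sigma> = {}" by (auto simp: matchings_def)
  with gen_zl [of "[]" V 0] show ?case by simp
next
  case (diff a b)
  then show ?case using gen_add [OF _ gen_minus] by fastforce
qed (rule gen_0)

text \<open>Orthogonality: the coefficients of a chain at pairs of edges \<open>ui\<close>,
  \<open>vj\<close> can be prescribed independently of each other.\<close>

lemma del_del_ins_ins:
  assumes "distinct [u, v, i, j]" "distinct [u, v, i', j']" "A \<in> ch s W" "u \<notin> W" "v \<notin> W"
  shows "del (ed u i) (del (ed v j) (ins (ed v j') (ins (ed u i') A))) = (if i = i' \<and> j = j' then A else 0)"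
proof -
  have [simp]: "fin_chain A" using assms by auto
  have dA [simp]: "del (ed u i) A = 0" "del (ed v j) A = 0"
    using assms by (auto intro!: del_outside)
  have "ed v j \<noteq> ed u i'" by (rule ed_neq) (use assms in auto)
  then have 1: "del (ed v j) (ins (ed u i') A) = 0"
    by (simp add: del_ins)
  show ?thesis
  proof (cases "j = j'")
    case True
    then have *: "del (ed v j) (ins (ed v j') (ins (ed u i') A)) = ins (ed u i') A"
      using 1 by (simp add: del_ins_same)
    show ?thesis
    proof (cases "i = i'")
      case True
      with \<open>j = j'\<close> dA show ?thesis unfolding * by (simp add: del_ins_same)
    next
      case False
      then have "ed u i \<noteq> ed u i'" by (intro ed_neq) (use assms in auto)
      then show ?thesis unfolding * using False by (simp add: del_ins)
    qed
  next
    case False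
    then have "ed v j \<noteq> ed v j'"
      by (intro ed_neq) (use assms(1,2) in \<open>simp_all add: doubleton_eq_iff\<close>)
    then have "del (ed v j) (ins (ed v j') (ins (ed u i') A)) = - ins (ed v j') (del (ed v j) (ins (ed u i') A))"
      by (intro del_ins) simp_all
    then show ?thesis using False 1 by simp
  qed
qed

text \<open>
  Two vertices \<open>u\<close>, \<open>v\<close> are singled out. The part of the cycle that uses both an edge
  \<open>ui\<close> and an edge \<open>vj\<close> lies in a range where everything bounds, so it can be removed; the
  remaining coefficients of \<open>ui\<close> and \<open>vj\<close> are generated by induction.
\<close>

theorem generation:
  assumes "finite V" "3 * s \<le> card V" "c \<in> cyc s V"
  shows "gen s V c"
  using assms
proof (induction s arbitrary: V c rule: less_induct)
  case (less s)
  show ?case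
  proof (cases s)
    case 0
    then show ?thesis using less.prems by (auto intro: gen_dim_0 cyc_ch)
  next
    case (Suc s')
    have "2 \<le> card V" using less.prems Suc by simp
    then obtain u v where uv: "u \<in> V" "v \<in> V" "u \<noteq> v"
      by (rule two_elements)
    define X where "X = V - {u, v}"
    define P where "P = {(i, j). i \<in> X \<and> j \<in> X \<and> i \<noteq> j}"
    have [simp]: "finite X" "u \<notin> X" "v \<notin> X" using less.prems by (auto simp: X_def)
    have eX [simp]: "ends (ed u i) = {u, i}" "ends (ed v i) = {v, i}" if "i \<in> X" for i
      by (rule ends_ed; use that in \<open>auto simp: X_def\<close>)+
    have PX: "distinct [u, v, i, j]" "i \<in> V" "j \<in> V" if "(i, j) \<in> P" for i j
      using that uv by (auto simp: P_def X_def)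
    have "finite P" by (rule finite_subset [of _ "X \<times> X"]) (auto simp: P_def)
    have cardX: "card (V - S) = card V - card S" if "S \<subseteq> V" for S
      using that less.prems by (meson card_Diff_subset finite_subset)
    have c: "c \<in> cyc (Suc s') V" using less.prems Suc by simp
    have "\<exists>A. A \<in> ch s' (V - {u, v, fst p, snd p}) \<and> del (ed u (fst p)) (del (ed v (snd p)) c) = bd A"
      if p: "p \<in> P" for p
    proof -
      obtain i j where ij: "p = (i, j)" "distinct [u, v, i, j]" "i \<in> V" "j \<in> V"
        using p PX by (cases p) auto
      have 1: "del (ed v j) c \<in> cyc s' (V - {v, j})"
        using del_cyc [OF c, of "ed v j"] ij by simp
      show ?thesis
      proof (cases s')
        case 0
        then have "del (ed u i) (del (ed v j) c) = 0" using 1 by (auto intro: del_ch_0 cyc_ch)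
        then show ?thesis using ij by (intro exI [of _ 0]) auto
      next
        case (Suc t)
        then have "del (ed u i) (del (ed v j) c) \<in> cyc t (V - {v, j} - ends (ed u i))"
          using 1 by (intro del_cyc) simp
        also have "V - {v, j} - ends (ed u i) = V - {u, v, i, j}" using ij by auto
        finally have 2: "del (ed u i) (del (ed v j) c) \<in> cyc t (V - {u, v, i, j})" .
        \<comment> \<open>The bound is tight: here \<open>s = t + 2\<close>, so
          \<open>3 * s \<le> card V\<close> leaves \<open>3 * t + 2\<close> vertices after
          \<open>u, v, i, j\<close> are removed, just enough for two spare ones.\<close>
        have 3: "3 * t + 2 \<le> card (V - {u, v, i, j})"
          using ij uv less.prems \<open>s = Suc s'\<close> Suc by (subst cardX) auto
        have "gen t (V - {u, v, i, j}) (del (ed u i) (del (ed v j) c))"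
          by (rule less.IH) (use 2 3 Suc \<open>s = Suc s'\<close> less.prems in auto)
        then have "del (ed u i) (del (ed v j) c) \<in> bdy t (V - {u, v, i, j})"
          using gen_imp_bdy 3 less.prems by blast
        then show ?thesis using ij Suc by (auto simp: bdy_def)
      qed
    qed
    then obtain A where A: "\<And>i j. (i, j) \<in> P \<Longrightarrow> A (i, j) \<in> ch s' (V - {u, v, i, j})"
      "\<And>i j. (i, j) \<in> P \<Longrightarrow> del (ed u i) (del (ed v j) c) = bd (A (i, j))"
      by (metis fst_conv snd_conv)
    \<comment> \<open>By orthogonality \<open>bd Y\<close> has the coefficient
      \<open>bd (A (i, j))\<close> at the pair \<open>ui\<close>, \<open>vj\<close>, the same as
      \<open>c\<close>.\<close>
    define Y where "Y = (\<Sum>(i, j)\<in>P. ins (ed v j) (ins (ed u i) (A (i, j))))"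
    have "ins (ed v j) (ins (ed u i) (A (i, j))) \<in> ch (Suc s) V" if "(i, j) \<in> P" for i j
    proof -
      have "ins (ed u i) (A (i, j)) \<in> ch (Suc s') (V - {v, j})"
        by (rule ins_ch [OF A(1) [OF that] edges_iff]) (use PX [OF that] uv in auto)
      then show ?thesis unfolding Suc
        by (rule ins_ch [OF _ edges_iff]) (use PX [OF that] uv in auto)
    qed
    then have Y: "Y \<in> ch (Suc s) V"
      unfolding Y_def by (intro ch_sum) auto
    define z where "z = c - bd Y"
    have z: "z \<in> cyc (Suc s') V"
      unfolding z_def using c bdy_cyc [OF bdyI [OF Y]] Suc by (auto intro: cyc_diff)
    have [simp]: "fin_chain Y" "fin_chain z" using Y z by auto
    have zz: "del (ed u i) (del (ed v j) z) = 0" if ij: "(i, j) \<in> P" for i j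
    proof -
      have "del (ed u i) (del (ed v j) Y) = (\<Sum>p\<in>P. if p = (i, j) then A p else 0)"
        unfolding Y_def linear_simps
      proof (intro sum.cong refl)
        fix p assume p: "p \<in> P"
        obtain i' j' where p': "p = (i', j')" by (cases p)
        show "del (ed u i) (del (ed v j) (case p of (i, j) \<Rightarrow> ins (ed v j) (ins (ed u i) (A (i, j)))))
          = (if p = (i, j) then A p else 0)"
          using del_del_ins_ins [OF PX(1) [OF ij] PX(1) [OF p [unfolded p']] A(1) [OF p [unfolded p']]] p'
          by auto
      qed
      also have "\<dots> = A (i, j)" using ij \<open>finite P\<close> by simp
      finally show ?thesis
        using A(2) [OF ij] by (simp add: z_def linear_simps del_bd)
    qed
    define b where "b i = del (ed u i) z" for i
    define b' where "b' i = del (ed v i) z" for i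
    \<comment> \<open>No term of \<open>z\<close> contains both an edge \<open>ui\<close> and an
      edge \<open>vj\<close>, so the coefficient of \<open>ui\<close> avoids \<open>v\<close>
      too.\<close>
    have b: "b i \<in> cyc s' (V - {u, v, i})" if i: "i \<in> X" for i
    proof -
      have bi: "b i \<in> cyc s' (V - {u, i})"
        unfolding b_def using del_cyc [OF z, of "ed u i"] i uv by (auto simp: X_def)
      have "b i \<in> ch s' (V - {u, i} - {v})"
      proof (rule vertex_avoid)
        fix j assume "j \<in> V - {u, i}" "adj v j"
        then have "(i, j) \<in> P" using i by (auto simp: P_def X_def)
        then show "del (ed v j) (b i) = 0"
          unfolding b_def using zz del_del [of z "ed v j" "ed u i"] by simp
      qed (use less.prems bi cyc_ch in auto)
      then show ?thesis using bi by (auto simp: cyc_def set_diff_eq insert_commute conj_ac elim: ch_mono [rotated])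
    qed
    have b': "b' i \<in> cyc s' (V - {u, v, i})" if i: "i \<in> X" for i
    proof -
      have bi: "b' i \<in> cyc s' (V - {v, i})"
        unfolding b'_def using del_cyc [OF z, of "ed v i"] i uv by (auto simp: X_def)
      have "b' i \<in> ch s' (V - {v, i} - {u})"
      proof (rule vertex_avoid)
        fix j assume "j \<in> V - {v, i}" "adj u j"
        then have "(j, i) \<in> P" using i by (auto simp: P_def X_def)
        then show "del (ed u j) (b' i) = 0"
          unfolding b'_def using zz by simp
      qed (use less.prems bi cyc_ch in auto)
      then show ?thesis using bi by (auto simp: cyc_def elim: ch_mono [rotated])
    qed
    have gen': "gen s' (V - {u, v, i}) x" if "x \<in> cyc s' (V - {u, v, i})" "i \<in> X" for i x
    proof (rule less.IH)
      have "card (V - {u, v, i}) = card V - 3" using that uv by (subst cardX) (auto simp: X_def)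
      then show "3 * s' \<le> card (V - {u, v, i})" using less.prems Suc by simp
    qed (use that less.prems Suc in auto)
    \<comment> \<open>The edge \<open>uv\<close> completes \<open>ins (ed u i) (b i)\<close> to a
      cycle without affecting the coefficients at edges from \<open>u\<close> or \<open>v\<close> to
      \<open>X\<close>.\<close>
    define g where "g i = ins (ed u i) (b i) - ins (ed u v) (b i)" for i
    define g' where "g' i = ins (ed v i) (b' i) - ins (ed u v) (b' i)" for i
    define G where "G = sum g X + sum g' X"
    have "gen s V (g i)" "gen s V (g' i)" if "i \<in> X" for i
      using gen_step [OF gen' [OF b [OF that] that], of i u v V]
        gen_step [OF gen' [OF b' [OF that] that], of i v u V] that uv
      by (auto simp: g_def g'_def Suc X_def ed_sym [of i] ed_sym [of v u])
    then have G: "gen s V G"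
      unfolding G_def by (intro gen_add gen_sum)
    define y where "y = z - G"
    have y: "y \<in> cyc (Suc s') V"
      using z gen_cyc [OF G] Suc by (auto simp: y_def intro: cyc_diff)
    have [simp]: "fin_chain y" using y by auto
    have fb: "fin_chain (b i)" "fin_chain (b' i)" for i by (auto simp: b_def b'_def)
    have yu: "del (ed u i) y = 0" if i: "i \<in> X" for i
    proof -
      have ne: "ed u i \<noteq> ed u v" "ed u i \<noteq> ed v j" if "j \<in> X" for j
        by (rule ed_neq; use that i uv in \<open>auto simp: X_def\<close>)+
      have 0: "del (ed u i) (b j) = 0" "del (ed u i) (b' j) = 0" if "j \<in> X" for j
        using b [OF that] b' [OF that] i by (auto intro!: del_outside [OF cyc_ch])
      have "del (ed u i) (sum g X) = (\<Sum>j\<in>X. if j = i then b i else 0)"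
        unfolding linear_simps
      proof (intro sum.cong refl)
        fix j assume j: "j \<in> X"
        have "j \<noteq> i \<Longrightarrow> ed u i \<noteq> ed u j"
          by (rule ed_neq) (use j i uv in \<open>auto simp: X_def\<close>)
        with j show "del (ed u i) (g j) = (if j = i then b i else 0)"
          using 0 [OF j] fb ne(1) by (auto simp: g_def linear_simps del_ins del_ins_same)
      qed
      also have "\<dots> = b i" using i by simp
      finally have 1: "del (ed u i) (sum g X) = b i" .
      have 2: "del (ed u i) (sum g' X) = 0"
        unfolding linear_simps
      proof (intro sum.neutral ballI)
        fix j assume j: "j \<in> X"
        then show "del (ed u i) (g' j) = 0"
          using 0 [OF j] fb ne [OF j] by (auto simp: g'_def linear_simps del_ins)
      qed
      show ?thesis using 1 2 by (simp add: y_def G_def linear_simps b_def)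
    qed
    have yv: "del (ed v i) y = 0" if i: "i \<in> X" for i
    proof -
      have ne: "ed v i \<noteq> ed u v" "ed v i \<noteq> ed u j" if "j \<in> X" for j
        by (rule ed_neq; use that i uv in \<open>auto simp: X_def\<close>)+
      have 0: "del (ed v i) (b j) = 0" "del (ed v i) (b' j) = 0" if "j \<in> X" for j
        using b [OF that] b' [OF that] i by (auto intro!: del_outside [OF cyc_ch])
      have "del (ed v i) (sum g' X) = (\<Sum>j\<in>X. if j = i then b' i else 0)"
        unfolding linear_simps
      proof (intro sum.cong refl)
        fix j assume j: "j \<in> X"
        have "j \<noteq> i \<Longrightarrow> ed v i \<noteq> ed v j"
          by (rule ed_neq) (use j i uv in \<open>auto simp: X_def\<close>)
        with j show "del (ed v i) (g' j) = (if j = i then b' i else 0)"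
          using 0 [OF j] fb ne(1) by (auto simp: g'_def linear_simps del_ins del_ins_same)
      qed
      also have "\<dots> = b' i" using i by simp
      finally have 1: "del (ed v i) (sum g' X) = b' i" .
      have 2: "del (ed v i) (sum g X) = 0"
        unfolding linear_simps
      proof (intro sum.neutral ballI)
        fix j assume j: "j \<in> X"
        then show "del (ed v i) (g j) = 0"
          using 0 [OF j] fb ne [OF j] by (auto simp: g_def linear_simps del_ins)
      qed
      show ?thesis using 1 2 by (simp add: y_def G_def linear_simps b'_def)
    qed
    \<comment> \<open>The only edge at \<open>u\<close> or \<open>v\<close> left in \<open>y\<close>
      is \<open>uv\<close>. Without the terms containing it the chain avoids both vertices, so
      multiplication by \<open>uv\<close> yields matchings; it kills the omitted terms anyway, and
      hence \<open>y\<close> is the boundary of \<open>ins (ed u v) y\<close>.\<close>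
    define y0 where "y0 = y - ins (ed u v) (del (ed u v) y)"
    have duv: "del (ed u v) y \<in> ch s' (V - {u, v})"
      using del_ch [OF cyc_ch [OF y], of "ed u v"] uv by simp
    have y0: "y0 \<in> ch (Suc s') V"
      unfolding y0_def by (intro ch_diff cyc_ch [OF y] ins_ch [OF duv] edges_iff) (use uv in auto)
    have d0: "del (ed u v) y0 = 0"
      by (simp add: y0_def linear_simps del_ins_same)
    have d1: "del e y0 = 0" if "e \<noteq> ed u v" "del e y = 0" for e
      using that del_del [of y e "ed u v"] by (simp add: y0_def linear_simps del_ins)
    have d2: "del (ed u i) y0 = 0" if "i \<in> X" for i
      by (intro d1 yu ed_neq) (use that uv in \<open>auto simp: X_def\<close>)
    have d3: "del (ed v i) y0 = 0" if "i \<in> X" for i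
      by (intro d1 yv ed_neq) (use that uv in \<open>auto simp: X_def\<close>)
    have "y0 \<in> ch (Suc s') (V - {u})"
    proof (rule vertex_avoid [OF less.prems(1) y0])
      fix j assume "j \<in> V" "adj u j"
      then show "del (ed u j) y0 = 0"
        using d0 d2 [of j] adj_irrefl [of u j] by (cases "j = v") (auto simp: X_def)
    qed
    then have "y0 \<in> ch (Suc s') (V - {u} - {v})"
    proof (rule vertex_avoid [rotated])
      fix j assume "j \<in> V - {u}" "adj v j"
      then show "del (ed v j) y0 = 0"
        using d3 [of j] adj_irrefl [of v j] by (auto simp: X_def)
    qed (use less.prems in auto)
    then have "ins (ed u v) y0 \<in> ch (Suc (Suc s')) V"
      by (rule ins_ch [OF _ edges_iff]) (use uv in auto)
    moreover have "ins (ed u v) y0 = ins (ed u v) y" by (simp add: y0_def linear_simps)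
    moreover have "bd (ins (ed u v) y) = y" using cyc_bd [OF y] by (simp add: bd_ins)
    ultimately have "y \<in> bdy s V" using bdyI Suc by metis
    then have "gen s V (G + y + bd Y)"
      by (intro gen_add gen_bdy G bdyI Y)
    then show ?thesis by (simp add: y_def z_def)
  qed
qed

corollary cyc_imp_bdy:
  assumes "finite V" "3 * s + 2 \<le> card V" "c \<in> cyc s V"
  shows "c \<in> bdy s V"
  using assms by (intro gen_imp_bdy generation) auto

end

section \<open>Signs of vertex lists\<close>

text \<open>On distinct lists this is the sign of the sorting permutation, obtained by counting
  inversions.\<close>

fun lsgn :: "'v::linorder list \<Rightarrow> int"
  where "lsgn [] = 1"
  | "lsgn (x # l) = (-1) ^ card {y \<in> set l. y < x} * lsgn l"

lemma lsgn_square [simp]: "lsgn l * lsgn l = 1"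
proof (induction l)
  case (Cons x l)
  have "lsgn (x # l) * lsgn (x # l) = ((-1) ^ card {y \<in> set l. y < x} * (-1) ^ card {y \<in> set l. y < x}) * (lsgn l * lsgn l)"
    by (simp only: lsgn.simps ac_simps)
  also have "\<dots> = 1" unfolding Cons by (simp flip: power_add)
  finally show ?case .
qed simp

lemma lsgn_swap2:
  assumes "x \<noteq> y" "x \<notin> set l" "y \<notin> set l"
  shows "lsgn (x # y # l) = - lsgn (y # x # l)"
proof -
  have *: "card {z \<in> set (b # l). z < a} = (if b < a then Suc (card {z \<in> set l. z < a}) else card {z \<in> set l. z < a})"
    if "b \<notin> set l" for a b
  proof (cases "b < a")
    case True
    then have "{z \<in> set (b # l). z < a} = insert b {z \<in> set l. z < a}" by auto
    with that True show ?thesis by simp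
  next
    case False
    then have "{z \<in> set (b # l). z < a} = {z \<in> set l. z < a}" by auto
    with False show ?thesis by simp
  qed
  have 1: "lsgn (x # y # l) = (-1) ^ (if y < x then Suc (card {z \<in> set l. z < x}) else card {z \<in> set l. z < x}) *
      ((-1) ^ card {z \<in> set l. z < y} * lsgn l)"
    by (simp only: lsgn.simps * [OF assms(3)])
  have 2: "lsgn (y # x # l) = (-1) ^ (if x < y then Suc (card {z \<in> set l. z < y}) else card {z \<in> set l. z < y}) *
      ((-1) ^ card {z \<in> set l. z < x} * lsgn l)"
    by (simp only: lsgn.simps * [OF assms(2)])
  consider "x < y" "\<not> y < x" | "y < x" "\<not> x < y" using assms(1) by force
  then show ?thesis
    unfolding 1 2 by cases simp_all
qed

lemma lsgn_swap_adjacent: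
  "distinct (xs @ a # b # ys) \<Longrightarrow> lsgn (xs @ a # b # ys) = - lsgn (xs @ b # a # ys)"
proof (induction xs)
  case Nil
  then show ?case using lsgn_swap2 [of a b ys] by simp
next
  case (Cons x xs)
  have "set (xs @ a # b # ys) = set (xs @ b # a # ys)" by auto
  with Cons show ?case by (simp only: append_Cons lsgn.simps) simp
qed

lemma lsgn_front:
  "distinct (xs @ a # ys) \<Longrightarrow> lsgn (xs @ a # ys) = (-1) ^ length xs * lsgn (a # xs @ ys)"
proof (induction xs)
  case (Cons x xs)
  have "lsgn (x # xs @ a # ys) = (-1) ^ length xs * lsgn (x # a # xs @ ys)"
    using Cons by simp
  also have "lsgn (x # a # xs @ ys) = - lsgn (a # x # xs @ ys)"
    by (rule lsgn_swap2) (use Cons in auto)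
  finally show ?case by simp
qed simp

declare lsgn.simps [simp del]

lemma lsgn_swap:
  "distinct (xs @ a # ys @ b # zs) \<Longrightarrow> lsgn (xs @ a # ys @ b # zs) = - lsgn (xs @ b # ys @ a # zs)"
proof (induction ys arbitrary: xs)
  case Nil
  then show ?case using lsgn_swap_adjacent [of xs a b zs] by simp
next
  case (Cons y ys)
  have "lsgn (xs @ a # y # ys @ b # zs) = - lsgn (xs @ y # a # ys @ b # zs)"
    by (rule lsgn_swap_adjacent) (use Cons in auto)
  also have "\<dots> = lsgn (xs @ y # b # ys @ a # zs)"
    using Cons.IH [of "xs @ [y]"] Cons.prems by (auto)
  also have "\<dots> = - lsgn (xs @ b # y # ys @ a # zs)"
    by (rule lsgn_swap_adjacent) (use Cons in auto)
  finally show ?case by simp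
qed

text \<open>Moving three entries past \<open>length xs\<close> others has the parity of
  \<open>length xs\<close>. Pulling \<open>a\<close>, \<open>b\<close>, \<open>c\<close> forward one
  at a time reverses them, which the last exchange repairs.\<close>

lemma lsgn_front3:
  assumes "distinct (xs @ a # b # c # ys)"
  shows "lsgn (xs @ a # b # c # ys) = (-1) ^ length xs * lsgn (a # b # c # xs @ ys)"
proof -
  have "lsgn (xs @ a # b # c # ys) = (-1) ^ length xs * lsgn (a # xs @ b # c # ys)"
    using lsgn_front [of xs a "b # c # ys"] assms by (auto)
  also have "lsgn (a # xs @ b # c # ys) = (-1) ^ Suc (length xs) * lsgn (b # a # xs @ c # ys)"
    using lsgn_front [of "a # xs" b "c # ys"] assms by (auto)
  also have "lsgn (b # a # xs @ c # ys) = (-1) ^ Suc (Suc (length xs)) * lsgn (c # b # a # xs @ ys)"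
    using lsgn_front [of "b # a # xs" c ys] assms by (auto)
  also have "lsgn (c # b # a # xs @ ys) = - lsgn (a # b # c # xs @ ys)"
    using lsgn_swap [of "[]" c "[b]" a "xs @ ys"] assms by (auto)
  finally show ?thesis by (auto simp: minus_one_power_iff)
qed

section \<open>A functional with values modulo three\<close>

lemma three_eq_0: "(3 :: 3) = 0"
  by simp

lemma double_mod3: "(x :: 3) + x = - x"
proof -
  have "x + x - (- x) = 3 * x" by (simp add: algebra_simps)
  then show ?thesis by (simp only: three_eq_0 mult_zero_left right_minus_eq)
qed

context complete_graph
begin

text \<open>Additivity is demanded on cycles only, so nothing has to be extended to chains. On
  \<open>3 * k + 1\<close> vertices the last entry of \<open>l\<close> enters the sign but not the
  product.\<close>

definition omega :: "nat \<Rightarrow> 'v set \<Rightarrow> (('e set \<Rightarrow>\<^sub>0 int) \<Rightarrow> 3) \<Rightarrow> bool"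
  where "omega k V w \<longleftrightarrow>
    (\<forall>a\<in>cyc k V. \<forall>b\<in>cyc k V. w (a + b) = w a + w b) \<and> (\<forall>c\<in>bdy k V. w c = 0) \<and>
    (\<forall>l. distinct l \<and> set l = V \<longrightarrow> w (zl l (frag_of {})) = of_int (lsgn l))"

lemma triple_split:
  fixes m :: "'v list"
  assumes "3 dvd length m" "u \<in> set m"
  obtains xs a b c ys where "m = xs @ a # b # c # ys" "3 dvd length xs" "u \<in> {a, b, c}"
proof -
  have "\<exists>xs a b c ys. m = xs @ a # b # c # ys \<and> 3 dvd length xs \<and> u \<in> {a, b, c}"
    using assms
  proof (induction m rule: path_triples.induct)
    case (1 a b c l)
    show ?case
    proof (cases "u \<in> {a, b, c}")
      case True
      then show ?thesis by (intro exI [of _ "[]"]) auto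
    next
      case False
      with 1 obtain xs a' b' c' ys where "l = xs @ a' # b' # c' # ys" "3 dvd length xs" "u \<in> {a', b', c'}"
        by (auto simp: three_dvd_simps)
      then show ?thesis by (intro exI [of _ "a # b # c # xs"]) (auto simp: three_dvd_simps)
    qed
  qed (auto simp: three_dvd_simps)
  then show ?thesis using that by blast
qed

text \<open>
  For a cycle \<open>c\<close> avoiding \<open>v\<close> the functional is \<open>\<Sum>\<^sub>i \<phi>\<^sub>i (del ui c)\<close>, where \<open>\<phi>\<^sub>i\<close> is the functional on
  \<open>V - {u, v, i}\<close> normalised so that \<open>zl l\<close> goes to the sign of \<open>i # u # v # l\<close>; on cycles that
  avoid both \<open>i\<close> and \<open>j\<close> one then has \<open>\<phi>\<^sub>i = - \<phi>\<^sub>j\<close>. Every cycle is homologous to one avoiding \<open>v\<close>.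
  Characteristic three enters through \<open>\<phi>\<^sub>i - \<phi>\<^sub>j = 2 \<phi>\<^sub>i = - \<phi>\<^sub>i\<close>.
\<close>

lemma omega_Suc:
  assumes V: "finite V" "card V = 3 * Suc k + 1"
    and IH: "\<And>V'. finite V' \<Longrightarrow> card V' = 3 * k + 1 \<Longrightarrow> \<exists>w. omega k V' w"
  shows "\<exists>w. omega (Suc k) V w"
proof -
  have "2 \<le> card V" using V by simp
  then obtain u v where uv: "u \<in> V" "v \<in> V" "u \<noteq> v" by (rule two_elements)
  define X where "X = V - {u, v}"
  have X [simp]: "finite X" "u \<notin> X" "v \<notin> X" "X \<subseteq> V" using V by (auto simp: X_def)
  have cardV: "card (V - S) = card V - card S" if "S \<subseteq> V" for S
    using that V by (meson card_Diff_subset finite_subset)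
  have cardX: "card X = 3 * k + 2" unfolding X_def using V uv by (subst cardV) auto
  have VX: "V = insert u (insert v X)" using uv by (auto simp: X_def)
  have eX [simp]: "ends (ed u i) = {u, i}" "ends (ed v i) = {v, i}" if "i \<in> X" for i
    by (rule ends_ed; use that in \<open>auto simp: X_def\<close>)+

  have "\<exists>\<phi> :: _ \<Rightarrow> 3. (\<forall>a\<in>cyc k (X - {i}). \<forall>b\<in>cyc k (X - {i}). \<phi> (a + b) = \<phi> a + \<phi> b) \<and>
      (\<forall>c\<in>bdy k (X - {i}). \<phi> c = 0) \<and>
      (\<forall>l. distinct l \<and> set l = X - {i} \<longrightarrow> \<phi> (zl l (frag_of {})) = of_int (lsgn (i # u # v # l)))"
    if i: "i \<in> X" for i
  proof -
    have "card (X - {i}) = 3 * k + 1" using cardX i by simp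
    then obtain w where w: "omega k (X - {i}) w" using IH [of "X - {i}"] by auto
    \<comment> \<open>The inversions caused by \<open>i, u, v\<close> depend only on the set of
      \<open>l\<close>, which is fixed, so the required normalisation is multiplication by a
      constant sign.\<close>
    define \<rho> :: int where "\<rho> = (-1) ^ card {y \<in> insert u (insert v (X - {i})). y < i} *
      ((-1) ^ card {y \<in> insert v (X - {i}). y < u} * (-1) ^ card {y \<in> X - {i}. y < v})"
    have *: "lsgn (i # u # v # l) = \<rho> * lsgn l" if "set l = X - {i}" for l
      using that by (simp add: \<rho>_def mult.assoc lsgn.simps)
    show ?thesis
      by (rule exI [of _ "\<lambda>c. of_int \<rho> * w c"])
        (use w in \<open>auto simp: omega_def distrib_left *\<close>)
  qed
  then have "\<exists>\<phi> :: 'v \<Rightarrow> _ \<Rightarrow> 3. \<forall>i\<in>X.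
      (\<forall>a\<in>cyc k (X - {i}). \<forall>b\<in>cyc k (X - {i}). \<phi> i (a + b) = \<phi> i a + \<phi> i b) \<and>
      (\<forall>c\<in>bdy k (X - {i}). \<phi> i c = 0) \<and>
      (\<forall>l. distinct l \<and> set l = X - {i} \<longrightarrow> \<phi> i (zl l (frag_of {})) = of_int (lsgn (i # u # v # l)))"
    by (intro bchoice ballI)
  then obtain \<phi> :: "'v \<Rightarrow> _ \<Rightarrow> 3" where
    \<phi>_add: "\<And>i a b. i \<in> X \<Longrightarrow> a \<in> cyc k (X - {i}) \<Longrightarrow> b \<in> cyc k (X - {i}) \<Longrightarrow> \<phi> i (a + b) = \<phi> i a + \<phi> i b"
    and \<phi>_bdy: "\<And>i c. i \<in> X \<Longrightarrow> c \<in> bdy k (X - {i}) \<Longrightarrow> \<phi> i c = 0"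
    and \<phi>_zl: "\<And>i l. i \<in> X \<Longrightarrow> distinct l \<Longrightarrow> set l = X - {i} \<Longrightarrow>
      \<phi> i (zl l (frag_of {})) = of_int (lsgn (i # u # v # l))"
    by (elim exE) blast
  have \<phi>_0: "\<phi> i 0 = 0" if "i \<in> X" for i using \<phi>_bdy [OF that] by simp
  have \<phi>_minus: "\<phi> i (- a) = - \<phi> i a" if "i \<in> X" "a \<in> cyc k (X - {i})" for i a
    using \<phi>_add [OF that(1) that(2), of "- a"] that \<phi>_0 by (simp add: eq_neg_iff_add_eq_0 add.commute)
  have \<phi>_sum: "\<phi> i (sum f I) = (\<Sum>j\<in>I. \<phi> i (f j))"
    if "i \<in> X" "\<And>j. j \<in> I \<Longrightarrow> f j \<in> cyc k (X - {i})" for i I and f :: "'v \<Rightarrow> _"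
    using that by (induction I rule: infinite_finite_induct) (auto simp: \<phi>_0 \<phi>_add cyc_sum)

  \<comment> \<open>A product generating the cycles on the \<open>3 * k\<close> vertices
    \<open>X - {i, j}\<close> uses all of them; appending \<open>j\<close> or \<open>i\<close> gives
    two spanning lists whose signs differ by one transposition.\<close>
  have anti: "\<phi> i c = - \<phi> j c" if ij: "i \<in> X" "j \<in> X" "i \<noteq> j" and c: "c \<in> cyc k (X - {i, j})" for i j c
  proof -
    have card: "card (X - {i, j}) = 3 * k" using ij cardX by (subst card_Diff_subset) auto
    then have "gen k (X - {i, j}) c" using c by (intro generation) auto
    then show ?thesis
    proof (induction rule: gen.induct)
      case (gen_zl l)
      then have l: "set l = X - {i, j}"
        using card by (intro card_subset_eq) (auto simp: distinct_card)
      have "zl (l @ [x]) (frag_of {}) = zl l (frag_of {})" for x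
        using gen_zl(3) by (subst zl_append) auto
      moreover have "\<phi> i (zl (l @ [j]) (frag_of {})) = of_int (lsgn (i # u # v # l @ [j]))"
        by (rule \<phi>_zl) (use ij l gen_zl in auto)
      moreover have "\<phi> j (zl (l @ [i]) (frag_of {})) = of_int (lsgn (j # u # v # l @ [i]))"
        by (rule \<phi>_zl) (use ij l gen_zl in auto)
      moreover have "lsgn (i # u # v # l @ [j]) = - lsgn (j # u # v # l @ [i])"
        using lsgn_swap [of "[]" i "u # v # l" j "[]"] ij l gen_zl uv by (auto simp: X_def)
      ultimately show ?case by (metis of_int_minus)
    next
      case (gen_bdy c)
      have "c \<in> bdy k (X - {i})" "c \<in> bdy k (X - {j})"
        by (rule bdy_mono [OF _ gen_bdy], blast)+
      then show ?case using \<phi>_bdy ij by simp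
    next
      case (gen_add a b)
      have "a \<in> cyc k (X - {i})" "a \<in> cyc k (X - {j})" "b \<in> cyc k (X - {i})" "b \<in> cyc k (X - {j})"
        by (rule cyc_mono [OF _ gen_cyc [OF gen_add(1)]] cyc_mono [OF _ gen_cyc [OF gen_add(2)]], blast)+
      then show ?case using gen_add ij by (simp add: \<phi>_add)
    next
      case (gen_minus a)
      have "a \<in> cyc k (X - {i})" "a \<in> cyc k (X - {j})"
        by (rule cyc_mono [OF _ gen_cyc [OF gen_minus(1)]], blast)+
      then show ?case using gen_minus ij by (simp add: \<phi>_minus)
    qed
  qed

  have ne_u: "ed u i \<noteq> ed u x" if "i \<in> X" "x \<in> X" "i \<noteq> x" for i x
    by (rule ed_neq) (use that in \<open>auto simp: X_def doubleton_eq_iff\<close>)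

  define \<Omega> where "\<Omega> c = (\<Sum>i\<in>X. \<phi> i (del (ed u i) c))" for c
  have VvX: "V - {v} = insert u X" using uv by (auto simp: X_def)
  have del_u: "del (ed u i) z \<in> cyc k (X - {i})" if "z \<in> cyc (Suc k) (insert u X)" "i \<in> X" for z i
    using del_cyc [OF that(1), of "ed u i"] that(2) by (simp add: insert_Diff_if)
  have \<Omega>_add: "\<Omega> (a + b) = \<Omega> a + \<Omega> b" if "a \<in> cyc (Suc k) (insert u X)" "b \<in> cyc (Suc k) (insert u X)" for a b
    using del_u [OF that(1)] del_u [OF that(2)]
    by (simp add: \<Omega>_def linear_simps \<phi>_add sum.distrib)
  have \<Omega>_0: "\<Omega> 0 = 0" by (simp add: \<Omega>_def \<phi>_0)
  have \<Omega>_sum: "\<Omega> (sum f I) = (\<Sum>j\<in>I. \<Omega> (f j))"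
    if "\<And>j. j \<in> I \<Longrightarrow> f j \<in> cyc (Suc k) (insert u X)" for I and f :: "'v \<Rightarrow> _"
    using that by (induction I rule: infinite_finite_induct) (auto simp: \<Omega>_0 \<Omega>_add cyc_sum)

  \<comment> \<open>This makes \<open>w\<close> well defined: a boundary may avoid \<open>v\<close>
    although the chain \<open>y\<close> filling it does not. The coefficients \<open>A j\<close> of
    \<open>y\<close> at the edges \<open>vj\<close> are cycles because \<open>bd y\<close> avoids
    \<open>v\<close>, and \<open>bd y\<close> is their sum plus a boundary off
    \<open>v\<close>.\<close>
  have kernel: "\<Omega> (bd y) = 0" if y: "y \<in> ch (Suc (Suc k)) V" and yb: "bd y \<in> ch (Suc k) (insert u X)" for y
  proof -
    have [simp]: "fin_chain y" using y by auto
    define A where "A j = del (ed v j) y" for j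
    have A: "A j \<in> cyc (Suc k) (V - {v, j})" if "j \<in> insert u X" for j
    proof -
      have e: "ends (ed v j) = {v, j}" by (rule ends_ed, rule adj_neq) (use that uv in \<open>auto simp: X_def\<close>)
      have "bd (A j) = - del (ed v j) (bd y)" by (simp add: A_def del_bd)
      also have "\<dots> = 0" using del_outside [OF yb] e uv by simp
      finally show ?thesis using del_ch [OF y, of "ed v j"] e by (simp add: A_def cyc_def)
    qed
    define y0 where "y0 = y - (\<Sum>j\<in>insert u X. ins (ed v j) (A j))"
    have N: "{j \<in> V. adj v j} = insert u X" using uv by (auto simp: X_def dest: adj_irrefl)
    have y0: "y0 \<in> ch (Suc (Suc k)) (insert u X)"
      using vertex_split [OF V(1) y, of v] unfolding N VvX y0_def A_def .
    have "bd (ins (ed v j) (A j)) = A j" if "j \<in> insert u X" for j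
      using cyc_bd [OF A [OF that]] by (simp add: bd_ins A_def)
    then have bdy_eq: "bd y = bd y0 + (\<Sum>j\<in>insert u X. A j)"
      by (simp add: y0_def linear_simps)
    have A': "A j \<in> cyc (Suc k) (insert u X)" if "j \<in> insert u X" for j
      by (rule cyc_mono [OF _ A [OF that]]) (use uv in \<open>auto simp: X_def\<close>)
    have "\<Omega> (bd y0) = 0"
      unfolding \<Omega>_def
    proof (intro sum.neutral ballI)
      fix i assume i: "i \<in> X"
      have "del (ed u i) (bd y0) \<in> bdy k (insert u X - ends (ed u i))"
        by (rule del_bdy [OF bdyI [OF y0]])
      then have "del (ed u i) (bd y0) \<in> bdy k (X - {i})" using i by (simp add: insert_Diff_if)
      then show "\<phi> i (del (ed u i) (bd y0)) = 0" by (rule \<phi>_bdy [OF i])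
    qed
    moreover have "\<Omega> (A u) = 0"
    proof -
      have "del (ed u i) (A u) = 0" if "i \<in> X" for i
        by (rule del_outside [OF cyc_ch [OF A]]) (use that in auto)
      then show ?thesis by (simp add: \<Omega>_def \<phi>_0)
    qed
    moreover have "\<Omega> (A j) = 0" if j: "j \<in> X" for j
    proof -
      define c where "c i = del (ed u i) (A j)" for i
      have Aj: "A j \<in> cyc (Suc k) (insert u (X - {j}))"
      proof -
        have "V - {v, j} = insert u (X - {j})" using uv j by (auto simp: X_def)
        then show ?thesis using A [of j] j by simp
      qed
      have c: "c i \<in> cyc k (X - {i, j})" if "i \<in> X - {j}" for i
      proof -
        have "insert u (X - {j}) - ends (ed u i) = X - {i, j}" using that by (auto simp: X_def)
        then show ?thesis using del_cyc [OF Aj, of "ed u i"] by (simp add: c_def)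
      qed
      have cj: "c j = 0"
        unfolding c_def by (rule del_outside [OF cyc_ch [OF Aj]]) (use j in auto)
      \<comment> \<open>Since \<open>A j\<close> is a cycle, its coefficients \<open>c i\<close> at
        the edges \<open>ui\<close> add up to a boundary off \<open>j\<close>. By
        \<open>anti\<close> every \<open>\<phi> i\<close> may be replaced by
        \<open>- \<phi> j\<close>, which vanishes on that sum.\<close>
      define B where "B = A j - (\<Sum>i\<in>X - {j}. ins (ed u i) (c i))"
      have N: "{i \<in> insert u (X - {j}). adj u i} = X - {j}" by (auto dest: adj_irrefl)
      have "B \<in> ch (Suc k) (insert u (X - {j}) - {u})"
        using vertex_split [OF _ cyc_ch [OF Aj], of u] unfolding N B_def c_def by simp
      then have B: "B \<in> ch (Suc k) (X - {j})" by (simp add: insert_Diff_if)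
      have "bd (ins (ed u i) (c i)) = c i" if "i \<in> X - {j}" for i
        using cyc_bd [OF c [OF that]] cyc_fin [OF c [OF that]] by (simp add: bd_ins)
      then have "(\<Sum>i\<in>X - {j}. c i) = - bd B"
        using cyc_bd [OF Aj] by (simp add: B_def linear_simps)
      then have 1: "(\<Sum>i\<in>X - {j}. c i) \<in> bdy k (X - {j})"
        using bdy_minus [OF bdyI [OF B]] by simp
      have cj': "c i \<in> cyc k (X - {j})" if "i \<in> X - {j}" for i
        by (rule cyc_mono [OF _ c [OF that]]) auto
      have "\<Omega> (A j) = (\<Sum>i\<in>X. \<phi> i (c i))" by (simp add: \<Omega>_def c_def)
      also have "\<dots> = (\<Sum>i\<in>X - {j}. \<phi> i (c i))"
        using j by (simp add: sum.remove [of X j] cj \<phi>_0)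
      also have "\<dots> = (\<Sum>i\<in>X - {j}. - \<phi> j (c i))"
        by (intro sum.cong refl anti) (use j c in auto)
      also have "\<dots> = - \<phi> j (\<Sum>i\<in>X - {j}. c i)"
        using \<phi>_sum [OF j cj', of "X - {j}"] by (simp add: sum_negf)
      also have "\<dots> = 0" using \<phi>_bdy [OF j 1] by simp
      finally show ?thesis .
    qed
    ultimately have \<Omega>A: "\<Omega> (bd y0) = 0" "(\<Sum>j\<in>insert u X. \<Omega> (A j)) = 0" by simp_all
    have "(\<Sum>j\<in>insert u X. A j) \<in> cyc (Suc k) (insert u X)" by (intro cyc_sum A')
    from \<Omega>_add [OF bdy_cyc [OF bdyI [OF y0]] this] show ?thesis
      using \<Omega>_sum [of "insert u X" A, OF A'] \<Omega>A unfolding bdy_eq by (simp only: simp_thms add_0_left)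
  qed

  have avoid: "\<exists>z'. z' \<in> cyc (Suc k) (insert u X) \<and> z - z' \<in> bdy (Suc k) V" if z: "z \<in> cyc (Suc k) V" for z
  proof -
    have "\<exists>A. A \<in> ch (Suc k) (V - {v, j}) \<and> del (ed v j) z = bd A" if j: "j \<in> insert u X" for j
    proof -
      have e: "ends (ed v j) = {v, j}" by (rule ends_ed, rule adj_neq) (use j uv in \<open>auto simp: X_def\<close>)
      have j': "v \<noteq> j" "j \<in> V" using j uv by (auto simp: X_def)
      \<comment> \<open>With \<open>v\<close> and \<open>j\<close> gone, \<open>3 * k + 2\<close>
        vertices remain for cycles with \<open>k\<close> edges, so all of these bound.\<close>
      have "card (V - {v, j}) = card V - card {v, j}" by (rule cardV) (use j' uv in auto)
      then have "card (V - {v, j}) = 3 * k + 2" using j' V by simp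
      then have "del (ed v j) z \<in> bdy k (V - {v, j})"
        using del_cyc [OF z, of "ed v j"] e V by (intro cyc_imp_bdy) auto
      then show ?thesis by (auto simp: bdy_def)
    qed
    then obtain A where A: "\<And>j. j \<in> insert u X \<Longrightarrow> A j \<in> ch (Suc k) (V - {v, j})"
      "\<And>j. j \<in> insert u X \<Longrightarrow> del (ed v j) z = bd (A j)" by metis
    \<comment> \<open>Adding \<open>bd Y\<close> trades each part of \<open>z\<close> that contains
      an edge \<open>vj\<close> for \<open>A j\<close>, which avoids \<open>v\<close>.\<close>
    define Y where "Y = (\<Sum>j\<in>insert u X. ins (ed v j) (A j))"
    have Y: "Y \<in> ch (Suc (Suc k)) V"
      unfolding Y_def
    proof (intro ch_sum)
      fix j assume j: "j \<in> insert u X"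
      then have j': "v \<noteq> j" "j \<in> V" using uv j by (auto simp: X_def)
      show "ins (ed v j) (A j) \<in> ch (Suc (Suc k)) V"
        by (rule ins_ch [OF A(1) [OF j] edges_iff]) (use j' uv in auto)
    qed
    have N: "{j \<in> V. adj v j} = insert u X" using uv by (auto simp: X_def dest: adj_irrefl)
    have "bd (ins (ed v j) (A j)) = A j - ins (ed v j) (del (ed v j) z)" if "j \<in> insert u X" for j
      using A [OF that] by (simp add: bd_ins)
    then have "z + bd Y = (z - (\<Sum>j\<in>insert u X. ins (ed v j) (del (ed v j) z))) + (\<Sum>j\<in>insert u X. A j)"
      by (simp add: Y_def linear_simps sum_subtractf)
    moreover have "z - (\<Sum>j\<in>insert u X. ins (ed v j) (del (ed v j) z)) \<in> ch (Suc k) (insert u X)"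
      using vertex_split [OF V(1) cyc_ch [OF z], of v] unfolding N VvX .
    moreover have "(\<Sum>j\<in>insert u X. A j) \<in> ch (Suc k) (insert u X)"
    proof (intro ch_sum)
      fix j assume "j \<in> insert u X"
      from A(1) [OF this] show "A j \<in> ch (Suc k) (insert u X)"
        by (rule ch_mono [rotated]) (use uv in \<open>auto simp: X_def\<close>)
    qed
    ultimately have "z + bd Y \<in> ch (Suc k) (insert u X)" by (simp only: ch_add)
    moreover have "bd (z + bd Y) = 0" using cyc_bd [OF z] Y by (simp add: linear_simps bd_bd)
    moreover have "z - (z + bd Y) \<in> bdy (Suc k) V" using bdy_minus [OF bdyI [OF Y]] by simp
    ultimately show ?thesis by (intro exI [of _ "z + bd Y"]) (auto simp: cyc_def)
  qed

  define w where "w z = \<Omega> (SOME z'. z' \<in> cyc (Suc k) (insert u X) \<and> z - z' \<in> bdy (Suc k) V)" for z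
  have uX: "insert u X \<subseteq> V" using uv by auto
  have w_eq: "w z = \<Omega> z'" if z': "z' \<in> cyc (Suc k) (insert u X)" "z - z' \<in> bdy (Suc k) V" for z z'
  proof -
    define z'' where "z'' = (SOME z'. z' \<in> cyc (Suc k) (insert u X) \<and> z - z' \<in> bdy (Suc k) V)"
    have z'': "z'' \<in> cyc (Suc k) (insert u X)" "z - z'' \<in> bdy (Suc k) V"
      using someI [of "\<lambda>z'. z' \<in> cyc (Suc k) (insert u X) \<and> z - z' \<in> bdy (Suc k) V", OF conjI [OF z']]
      unfolding z''_def [symmetric] by auto
    have "(z - z') - (z - z'') \<in> bdy (Suc k) V" by (intro bdy_diff z' z'')
    then have "z'' - z' \<in> bdy (Suc k) V" by simp
    then obtain y where y: "y \<in> ch (Suc (Suc k)) V" "z'' - z' = bd y" by (auto simp: bdy_def)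
    have d: "z'' - z' \<in> cyc (Suc k) (insert u X)" by (intro cyc_diff z' z'')
    have "\<Omega> (z'' - z') = 0"
      unfolding y(2) by (rule kernel [OF y(1)]) (use y(2) d cyc_ch in metis)
    then have "\<Omega> z'' = \<Omega> z'" using \<Omega>_add [OF d z'(1)] by simp
    then show ?thesis by (simp add: w_def z''_def)
  qed
  have w_add: "w (a + b) = w a + w b" if ab: "a \<in> cyc (Suc k) V" "b \<in> cyc (Suc k) V" for a b
  proof -
    obtain a' b' where a': "a' \<in> cyc (Suc k) (insert u X)" "a - a' \<in> bdy (Suc k) V"
      and b': "b' \<in> cyc (Suc k) (insert u X)" "b - b' \<in> bdy (Suc k) V"
      using avoid ab by metis
    have "a + b - (a' + b') \<in> bdy (Suc k) V"
      using bdy_add [OF a'(2) b'(2)] by (simp add: algebra_simps)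
    then have "w (a + b) = \<Omega> (a' + b')" by (intro w_eq cyc_add a' b')
    then show ?thesis using \<Omega>_add [OF a'(1) b'(1)] w_eq [OF a'] w_eq [OF b'] by simp
  qed
  have w_bdy: "w c = 0" if "c \<in> bdy (Suc k) V" for c
    using w_eq [of 0 c] that \<Omega>_0 by simp
  have w_minus: "w (- a) = - w a" if "a \<in> cyc (Suc k) V" for a
    using w_add [OF that, of "- a"] that w_bdy [of 0] by (simp add: eq_neg_iff_add_eq_0 add.commute)
  have w_cong: "w a = w b" if "a \<in> cyc (Suc k) V" "b \<in> cyc (Suc k) V" "a - b \<in> bdy (Suc k) V" for a b
    using w_add [of "a - b" b] that w_bdy [of "a - b"] cyc_diff by simp
  have w_\<Omega>: "w z = \<Omega> z" if "z \<in> cyc (Suc k) (insert u X)" for z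
    using w_eq [OF that, of z] by simp

  define Pr where "Pr l \<longleftrightarrow> w (zl l (frag_of {})) = of_int (lsgn l)" for l
  have zl_V: "zl l (frag_of {}) \<in> cyc (Suc k) V" if "distinct l" "set l = V" for l
    by (rule zl_cyc_empty) (use that V distinct_card [OF that(1)] in auto)
  have front: "Pr (xs @ a # b # c # ys)"
    if "Pr (a # b # c # xs @ ys)" "distinct (xs @ a # b # c # ys)" "set (xs @ a # b # c # ys) = V" "3 dvd length xs"
    for xs a b c ys
  proof -
    have "zl (a # b # c # xs @ ys) (frag_of {}) \<in> cyc (Suc k) V" by (rule zl_V) (use that in auto)
    then show ?thesis
      using that(1) w_minus unfolding Pr_def lsgn_front3 [OF that(2)] zl_front [OF fin_chain_simps(3) [THEN iffD2, OF finite.emptyI] that(4)]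
      by (auto simp del: zl.simps)
  qed
  have len: "length l = 3 * Suc k + 1" if "distinct l" "set l = V" for l
    using distinct_card [OF that(1)] that(2) V by simp

  \<comment> \<open>With \<open>v\<close> as free vertex the product itself avoids \<open>v\<close>,
    so \<open>w\<close> is computed by \<open>\<Omega>\<close> directly; only the triple containing
    \<open>u\<close> matters, and \<open>C\<close> is the product of the others.\<close>
  have last_v: "Pr (m @ [v])" if m: "distinct (m @ [v])" "set (m @ [v]) = V" for m
  proof -
    have "length m = 3 * Suc k" using len [OF m] by simp
    then have "3 dvd length m" by simp
    moreover have "u \<in> set m" using uv m by auto
    ultimately obtain xs a b c ys where abc: "m = xs @ a # b # c # ys" "3 dvd length xs" "u \<in> {a, b, c}"
      by (rule triple_split)
    define t where "t = xs @ ys"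
    have t: "length t = 3 * k" using \<open>length m = 3 * Suc k\<close> abc(1) by (simp add: t_def)
    have dist: "distinct (a # b # c # t @ [v])" "set (a # b # c # t @ [v]) = V"
      using m abc by (auto simp: t_def)
    define C where "C = zl t (frag_of {})"
    have zt: "zl (t @ [x]) (frag_of {}) = C" for x
      unfolding C_def using t by (subst zl_append) auto
    have C: "C \<in> cyc k (set t)" unfolding C_def by (rule zl_cyc_empty) (use dist t in auto)
    then have [simp]: "fin_chain C" by auto
    have dC: "del (ed u i) C = 0" if "i \<in> X" for i
      by (rule del_outside [OF cyc_ch [OF C]]) (use that dist abc in auto)
    have z: "zl (a # b # c # t @ [v]) (frag_of {}) \<in> cyc (Suc k) (insert u X)"
    proof -
      have "zl (a # b # c # t) (frag_of {}) \<in> cyc (Suc k) (insert u X)"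
        by (rule zl_cyc_empty) (use dist t VvX in auto)
      then show ?thesis by (simp add: zt C_def)
    qed
    have ins1: "\<Omega> (ins (ed u x) C) = \<phi> x C" if x: "x \<in> X" for x
    proof -
      have "\<phi> i (del (ed u i) (ins (ed u x) C)) = (if i = x then \<phi> x C else 0)" if "i \<in> X" for i
      proof (cases "i = x")
        case True
        then show ?thesis using dC [OF that] by (simp add: del_ins_same)
      next
        case False
        then have "ed u i \<noteq> ed u x" using that x by (intro ne_u)
        then show ?thesis using dC [OF that] False \<phi>_0 [OF that] by (simp add: del_ins)
      qed
      then show ?thesis using x by (simp add: \<Omega>_def)
    qed
    have ins2: "\<Omega> (x - ins (ed b' c') C) = \<Omega> x" "\<Omega> (ins (ed b' c') C - x) = - \<Omega> x"
      if "u \<notin> {b', c'}" "b' \<noteq> c'" "x = ins (ed u e) C" "e \<in> X" "set t \<subseteq> X - {e}" for b' c' x e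
    proof -
      have x: "del (ed u i) x \<in> cyc k (X - {i})" if "i \<in> X" for i
      proof (cases "i = e")
        case True
        then show ?thesis using dC [OF that] \<open>set t \<subseteq> X - {e}\<close> cyc_mono [OF _ C]
          by (simp add: \<open>x = ins (ed u e) C\<close> del_ins_same)
      next
        case False
        then have "ed u i \<noteq> ed u e" using that \<open>e \<in> X\<close> by (intro ne_u)
        then show ?thesis using dC [OF that] by (simp add: \<open>x = ins (ed u e) C\<close> del_ins)
      qed
      have "del (ed u i) (ins (ed b' c') C) = 0" if "i \<in> X" for i
      proof -
        have "ed u i \<noteq> ed b' c'" using that \<open>u \<notin> {b', c'}\<close> \<open>b' \<noteq> c'\<close> by (intro ed_neq) (auto simp: X_def)
        then show ?thesis using dC [OF that] by (simp add: del_ins)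
      qed
      then show "\<Omega> (x - ins (ed b' c') C) = \<Omega> x" "\<Omega> (ins (ed b' c') C - x) = - \<Omega> x"
        using x by (simp_all add: \<Omega>_def linear_simps \<phi>_minus sum_negf)
    qed
    have val: "\<phi> x C = of_int (lsgn (x # u # v # t @ [y]))" if "x \<in> X" "{x, y} \<union> set t = X" "distinct (x # y # t)" for x y
      using \<phi>_zl [OF that(1), of "t @ [y]"] that unfolding zt by auto
    have "Pr (a # b # c # t @ [v])"
    proof -
      consider "u = a" | "u = b" | "u = c" using abc by auto
      then show ?thesis
      proof cases
        case 1
        have X': "b \<in> X" "{b, c} \<union> set t = X" "distinct (b # c # t)" "set t \<subseteq> X - {b}" "c \<in> X"
          using dist 1 by (auto simp: X_def)
        have "w (zl (a # b # c # t @ [v]) (frag_of {})) = \<phi> b C"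
          using w_\<Omega> [OF z] ins2(1) [of b c "ins (ed u b) C" b] ins1 [of b] X' 1 dist by (simp add: zt)
        also have "\<dots> = of_int (lsgn (b # u # v # t @ [c]))" by (rule val) (use X' in auto)
        also have "lsgn (b # u # v # t @ [c]) = - lsgn (b # u # c # t @ [v])"
          using lsgn_swap [of "[b, u]" v t c "[]"] dist 1 by auto
        also have "\<dots> = lsgn (u # b # c # t @ [v])"
          using lsgn_swap2 [of b u "c # t @ [v]"] dist 1 by auto
        finally show ?thesis using 1 by (simp add: Pr_def)
      next
        \<comment> \<open>Both edges of the triple meet \<open>u\<close> only when \<open>u\<close>
          is its middle vertex; this is the case that forces arithmetic modulo 3.\<close>
        case 2
        have X': "a \<in> X" "{a, c} \<union> set t = X" "distinct (a # c # t)" "set t \<subseteq> X - {a}" "c \<in> X" "set t = X - {a, c}"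
          using dist 2 by (auto simp: X_def)
        have \<Omega>2: "\<Omega> (ins (ed u a) C - ins (ed u c) C) = \<Omega> (ins (ed u a) C) - \<Omega> (ins (ed u c) C)"
        proof -
          have "\<phi> i (del (ed u i) (ins (ed u a) C - ins (ed u c) C)) = (if i = a then \<phi> a C else 0) - (if i = c then \<phi> c C else 0)"
            if "i \<in> X" for i
          proof -
            have "del (ed u i) (ins (ed u x) C) = (if i = x then C else 0)" if "x \<in> {a, c}" for x
            proof (cases "i = x")
              case True
              then show ?thesis using dC [OF \<open>i \<in> X\<close>] by (simp add: del_ins_same)
            next
              case False
              then have "ed u i \<noteq> ed u x" using that X' \<open>i \<in> X\<close> by (intro ne_u) auto
              then show ?thesis using dC [OF \<open>i \<in> X\<close>] False by (simp add: del_ins)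
            qed
            moreover have "a \<noteq> c" using dist by auto
            moreover have "C \<in> cyc k (X - {c})" by (rule cyc_mono [OF _ C]) (use X' in auto)
            ultimately show ?thesis
              using \<phi>_0 \<phi>_minus [of c C] X' that by (auto simp: linear_simps)
          qed
          then show ?thesis using ins1 X' by (simp add: \<Omega>_def sum_subtractf)
        qed
        have "\<phi> c C = - \<phi> a C" by (rule anti) (use X' C dist in \<open>auto simp: insert_commute\<close>)
        then have "w (zl (a # b # c # t @ [v]) (frag_of {})) = \<phi> a C + \<phi> a C"
          using w_\<Omega> [OF z] \<Omega>2 ins1 X' 2 by (simp add: zt ed_sym [of a])
        also have "\<dots> = - of_int (lsgn (a # u # v # t @ [c]))"
          using val [of a c] X' by (simp add: double_mod3)
        also have "lsgn (a # u # v # t @ [c]) = - lsgn (a # u # c # t @ [v])"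
          using lsgn_swap [of "[a, u]" v t c "[]"] dist 2 by auto
        finally show ?thesis using 2 by (simp add: Pr_def)
      next
        case 3
        have X': "b \<in> X" "{b, a} \<union> set t = X" "distinct (b # a # t)" "set t \<subseteq> X - {b}" "a \<in> X"
          using dist 3 by (auto simp: X_def)
        have "w (zl (a # b # c # t @ [v]) (frag_of {})) = - \<phi> b C"
          using w_\<Omega> [OF z] ins2(2) [of a b "ins (ed u b) C" b] ins1 [of b] X' 3 dist by (auto simp: zt ed_sym [of b])
        also have "\<dots> = - of_int (lsgn (b # u # v # t @ [a]))" using val [of b a] X' by simp
        also have "lsgn (b # u # v # t @ [a]) = - lsgn (b # u # a # t @ [v])"
          using lsgn_swap [of "[b, u]" v t a "[]"] dist 3 by auto
        also have "lsgn (b # u # a # t @ [v]) = - lsgn (b # a # u # t @ [v])"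
          using lsgn_swap_adjacent [of "[b]" u a "t @ [v]"] dist 3 by auto
        also have "lsgn (b # a # u # t @ [v]) = - lsgn (a # b # u # t @ [v])"
          using lsgn_swap2 [of b a "u # t @ [v]"] dist 3 by auto
        finally show ?thesis using 3 by (simp add: Pr_def)
      qed
    qed
    then show ?thesis
      using front [of a b c xs "ys @ [v]"] m abc by (simp add: t_def)
  qed

  \<comment> \<open>If the free vertex \<open>x\<close> is not \<open>v\<close>, exchanging disjoint
    edges among \<open>a, b, c, x\<close> gives a homologous product with \<open>v\<close> free.
    Each of the three reorderings consists of two transpositions, so the sign is unchanged.\<close>
  have all: "Pr l" if l: "distinct l" "set l = V" for l
  proof -
    obtain m x where mx: "l = m @ [x]" using len [OF l] by (cases l rule: rev_cases) auto
    show ?thesis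
    proof (cases "x = v")
      case True
      then show ?thesis using last_v l mx by simp
    next
      case False
      have lm: "length m = 3 * Suc k" using len [OF l] mx by simp
      then have "3 dvd length m" by simp
      moreover have "v \<in> set m" using uv l mx False by auto
      ultimately obtain xs a b c ys where abc: "m = xs @ a # b # c # ys" "3 dvd length xs" "v \<in> {a, b, c}"
        by (rule triple_split)
      define t where "t = xs @ ys"
      have t: "length t = 3 * k" using lm abc(1) by (simp add: t_def)
      have dist: "distinct (a # b # c # t @ [x])" "set (a # b # c # t @ [x]) = V"
        using l mx abc by (auto simp: t_def)
      define C where "C = zl t (frag_of {})"
      have zt: "zl (t @ [y]) (frag_of {}) = C" for y
        unfolding C_def using t by (subst zl_append) auto
      have C: "C \<in> cyc k (set t)" unfolding C_def by (rule zl_cyc_empty) (use dist t in auto)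
      have swap: "ins (ed p q) C - ins (ed r s) C \<in> bdy (Suc k) V" if "distinct [p, q, r, s]" "{p, q, r, s} = {a, b, c, x}" for p q r s
        by (rule exchange_bdy [OF C]) (use that dist in auto)
      have Pr_cong: "Pr (a # b # c # t @ [x])"
        if "Pr l'" "distinct l'" "set l' = V" "lsgn l' = lsgn (a # b # c # t @ [x])"
          "zl (a # b # c # t @ [x]) (frag_of {}) - zl l' (frag_of {}) \<in> bdy (Suc k) V" for l'
        using that w_cong [OF zl_V [OF dist] zl_V [OF that(2,3)]] by (simp add: Pr_def)
      have "Pr (a # b # c # t @ [x])"
      proof -
        consider "v = a" | "v = b" | "v = c" using abc by auto
        then show ?thesis
        proof cases
          case 1
          show ?thesis
          proof (rule Pr_cong)
            show "Pr (x # c # b # t @ [a])" using last_v [of "x # c # b # t"] 1 dist by auto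
            show "distinct (x # c # b # t @ [a])" "set (x # c # b # t @ [a]) = V" using dist by auto
            have "lsgn (x # c # b # t @ [a]) = - lsgn (a # c # b # t @ [x])"
              using lsgn_swap [of "[]" x "c # b # t" a "[]"] dist by auto
            also have "lsgn (a # c # b # t @ [x]) = - lsgn (a # b # c # t @ [x])"
              using lsgn_swap_adjacent [of "[a]" c b "t @ [x]"] dist by auto
            finally show "lsgn (x # c # b # t @ [a]) = lsgn (a # b # c # t @ [x])" by simp
            have "zl (a # b # c # t @ [x]) (frag_of {}) - zl (x # c # b # t @ [a]) (frag_of {})
                = ins (ed a b) C - ins (ed x c) C"
              by (simp add: zt ed_sym [of c b])
            also have "\<dots> \<in> bdy (Suc k) V" by (rule swap) (use dist in auto)
            finally show "zl (a # b # c # t @ [x]) (frag_of {}) - zl (x # c # b # t @ [a]) (frag_of {}) \<in> bdy (Suc k) V" .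
          qed
        next
          case 2
          show ?thesis
          proof (rule Pr_cong)
            show "Pr (c # x # a # t @ [b])" using last_v [of "c # x # a # t"] 2 dist by auto
            show "distinct (c # x # a # t @ [b])" "set (c # x # a # t @ [b]) = V" using dist by auto
            have "lsgn (c # x # a # t @ [b]) = - lsgn (a # x # c # t @ [b])"
              using lsgn_swap [of "[]" c "[x]" a "t @ [b]"] dist by auto
            also have "lsgn (a # x # c # t @ [b]) = - lsgn (a # b # c # t @ [x])"
              using lsgn_swap [of "[a]" x "c # t" b "[]"] dist by auto
            finally show "lsgn (c # x # a # t @ [b]) = lsgn (a # b # c # t @ [x])" by simp
            have "zl (a # b # c # t @ [x]) (frag_of {}) - zl (c # x # a # t @ [b]) (frag_of {})
                = (ins (ed a b) C - ins (ed c x) C) - (ins (ed b c) C - ins (ed x a) C)"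
              by (simp add: zt algebra_simps)
            also have "\<dots> \<in> bdy (Suc k) V"
              by (rule bdy_diff; rule swap) (use dist in auto)
            finally show "zl (a # b # c # t @ [x]) (frag_of {}) - zl (c # x # a # t @ [b]) (frag_of {}) \<in> bdy (Suc k) V" .
          qed
        next
          case 3
          show ?thesis
          proof (rule Pr_cong)
            show "Pr (b # a # x # t @ [c])" using last_v [of "b # a # x # t"] 3 dist by auto
            show "distinct (b # a # x # t @ [c])" "set (b # a # x # t @ [c]) = V" using dist by auto
            have "lsgn (b # a # x # t @ [c]) = - lsgn (b # a # c # t @ [x])"
              using lsgn_swap [of "[b, a]" x t c "[]"] dist by auto
            also have "lsgn (b # a # c # t @ [x]) = - lsgn (a # b # c # t @ [x])"
              using lsgn_swap2 [of b a "c # t @ [x]"] dist by auto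
            finally show "lsgn (b # a # x # t @ [c]) = lsgn (a # b # c # t @ [x])" by simp
            have "zl (a # b # c # t @ [x]) (frag_of {}) - zl (b # a # x # t @ [c]) (frag_of {})
                = ins (ed a x) C - ins (ed b c) C"
              by (simp add: zt ed_sym [of b a])
            also have "\<dots> \<in> bdy (Suc k) V" by (rule swap) (use dist in auto)
            finally show "zl (a # b # c # t @ [x]) (frag_of {}) - zl (b # a # x # t @ [c]) (frag_of {}) \<in> bdy (Suc k) V" .
          qed
        qed
      qed
      then show ?thesis
        using front [of a b c xs "ys @ [x]"] l mx abc by (simp add: t_def)
    qed
  qed
  show ?thesis
    using w_add w_bdy all unfolding omega_def Pr_def by (intro exI [of _ w]) auto
qed

theorem omega_exists:
  "finite V \<Longrightarrow> card V = 3 * k + 1 \<Longrightarrow> \<exists>w. omega k V w"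
proof (induction k arbitrary: V)
  case 0
  then obtain x where V: "V = {x}" by (auto simp: card_1_singleton_iff)
  \<comment> \<open>A single vertex carries no edge, so only 0 bounds, and the coefficient of the
    empty matching serves as functional.\<close>
  have "ch (Suc 0) V = {0}"
  proof -
    have "matchings (Suc 0) V = {}"
      by (auto simp: matchings_def V card_1_singleton_iff edges_def dest: adj_irrefl)
    then show ?thesis by (auto simp: ch_def)
  qed
  then have "bdy 0 V = {0}" by (simp add: bdy_def)
  moreover have "of_int (Poly_Mapping.lookup (zl l (frag_of {})) {}) = (of_int (lsgn l) :: 3)"
    if "distinct l" "set l = V" for l
  proof -
    have "length l = 1" using that distinct_card [OF that(1)] V by simp
    then obtain y where "l = [y]" by (auto simp: length_Suc_conv)
    with that V show ?thesis by (simp add: lsgn.simps)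
  qed
  ultimately show ?case
    by (intro exI [of _ "\<lambda>c. of_int (Poly_Mapping.lookup c {})"]) (auto simp: omega_def Poly_Mapping.lookup_add)
next
  case (Suc k)
  then show ?case by (intro omega_Suc) auto
qed

end

section \<open>Torsion\<close>

lemma frag_cmul_2: "frag_cmul 2 x = x + x"
  using frag_cmul_distrib [of 1 1 x] by simp

context simple_graph
begin

text \<open>The column \<open>c5\<close> is absent from the product and provides the room for
  exchanges. The cycle \<open>C\<close> on the other vertices is arbitrary, so the relation persists
  after multiplication by further factors.\<close>

lemma six_torsion:
  assumes C: "C \<in> cyc s W"
    and dist: "distinct [r1, r2, r3, r4, r5]" "distinct [c1, c2, c3, c4, c5]"
    and adj: "\<And>r c. r \<in> {r1, r2, r3, r4, r5} \<Longrightarrow> c \<in> {c1, c2, c3, c4, c5} \<Longrightarrow> adj r c"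
    and disj: "{r1, r2, r3, r4, r5, c1, c2, c3, c4, c5} \<inter> W = {}"
    and V: "{r1, r2, r3, r4, r5, c1, c2, c3, c4, c5} \<union> W \<subseteq> V"
  shows "frag_cmul 6 (zl [c1, r1, c2, r2, c3, r3, r4, c4, r5] C) \<in> bdy (Suc (Suc (Suc s))) V"
proof -
  define R where "R = {r1, r2, r3, r4, r5}"
  define L where "L = {c1, c2, c3, c4, c5}"
  define f where "f a b c d = zl [a, r1, b, r2, c, r3, r4, d, r5] C" for a b c d
  define U where "U d = ins (ed r4 d) C - ins (ed d r5) C" for d
  define T where "T c d = ins (ed r2 c) (U d) - ins (ed c r3) (U d)" for c d
  have f: "f a b c d = ins (ed a r1) (T c d) - ins (ed r1 b) (T c d)" for a b c d
    by (simp add: f_def T_def U_def)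
  have R [simp]: "r1 \<in> R" "r2 \<in> R" "r3 \<in> R" "r4 \<in> R" "r5 \<in> R" by (simp_all add: R_def)
  have L: "c1 \<in> L" "c2 \<in> L" "c3 \<in> L" "c4 \<in> L" "c5 \<in> L" by (simp_all add: L_def)
  have adj_RL [simp]: "adj r c" "adj c r" if "r \<in> R" "c \<in> L" for r c
    using that adj adj_sym unfolding R_def L_def by metis+
  have ne [simp]: "r \<noteq> c" "c \<noteq> r" if "r \<in> R" "c \<in> L" for r c
    using adj_irrefl [OF adj_RL(1) [OF that]] by auto
  have comm: "ed c r = ed r c" if "r \<in> R" "c \<in> L" for r c
    using ed_commute [OF adj_RL(1) [OF that]] by simp
  have W [simp]: "r \<notin> W" if "r \<in> R" for r using that disj unfolding R_def by blast
  have W' [simp]: "c \<notin> W" if "c \<in> L" for c using that disj unfolding L_def by blast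
  have VR: "R \<subseteq> V" "L \<subseteq> V" "W \<subseteq> V" using V unfolding R_def L_def by auto
  have rne [simp]: "r1 \<noteq> r2" "r1 \<noteq> r3" "r1 \<noteq> r4" "r1 \<noteq> r5" "r2 \<noteq> r3" "r2 \<noteq> r4" "r2 \<noteq> r5" "r3 \<noteq> r4" "r3 \<noteq> r5" "r4 \<noteq> r5"
    using dist(1) by auto
  note rne [THEN not_sym, simp]
  have U: "U d \<in> cyc (Suc s) ({r4, r5, d} \<union> W)" if d: "d \<in> L" for d
    unfolding U_def by (rule ins_diff_cyc [OF C]) (use d in auto)
  have U_diff: "U d + U e \<in> bdy (Suc s) ({r4, r5, d, e} \<union> W)" if d: "d \<in> L" "e \<in> L" "d \<noteq> e" for d e
  proof -
    have "U d + U e = (ins (ed r4 d) C - ins (ed r5 e) C) + (ins (ed r4 e) C - ins (ed r5 d) C)"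
      using d by (simp add: U_def comm [of r5])
    also have "\<dots> \<in> bdy (Suc s) ({r4, r5, d, e} \<union> W)"
      by (rule bdy_add; rule exchange_bdy [OF C]) (use d in auto)
    finally show ?thesis .
  qed
  have T_diff1: "T c d + T e d \<in> bdy (Suc (Suc s)) ({r2, r3, c, e, r4, r5, d} \<union> W)"
    if "c \<in> L" "d \<in> L" "e \<in> L" "distinct [c, d, e]" for c d e
  proof -
    have "T c d + T e d = (ins (ed r2 c) (U d) - ins (ed r3 e) (U d)) + (ins (ed r2 e) (U d) - ins (ed r3 c) (U d))"
      using that by (simp add: T_def comm [of r3])
    also have "\<dots> \<in> bdy (Suc (Suc s)) ({r2, r3, c, e, r4, r5, d} \<union> W)"
      by (rule bdy_add; rule exchange_bdy [OF U]) (use that in auto)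
    finally show ?thesis .
  qed
  have T_diff2: "T c d + T c e \<in> bdy (Suc (Suc s)) ({r2, r3, c, e, r4, r5, d} \<union> W)"
    if "c \<in> L" "d \<in> L" "e \<in> L" "distinct [c, d, e]" for c d e
  proof -
    have "T c d + T c e = ins (ed r2 c) (U d + U e) - ins (ed c r3) (U d + U e)"
      by (simp add: T_def linear_simps)
    also have "\<dots> \<in> bdy (Suc (Suc s)) ({r2, r3, c, e, r4, r5, d} \<union> W)"
      by (rule ins_diff_bdy [OF U_diff]) (use that in auto)
    finally show ?thesis .
  qed
  have A: "f a b c d + f a b e d \<in> bdy (Suc (Suc (Suc s))) V"
    and B: "f a b c d + f a b c e \<in> bdy (Suc (Suc (Suc s))) V"
    if cols: "a \<in> L" "b \<in> L" "c \<in> L" "d \<in> L" "e \<in> L" "distinct [a, b, c, d, e]" for a b c d e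
  proof -
    have *: "{a, r1, r1, b} \<inter> ({r2, r3, c, e, r4, r5, d} \<union> W) = {}" using cols by auto
    have V': "{a, r1, r1, b} \<union> ({r2, r3, c, e, r4, r5, d} \<union> W) \<subseteq> V" using VR cols R by blast
    have cde: "distinct [c, d, e]" using cols by auto
    have ar: "adj a r1" "adj r1 b" using cols by auto
    have "f a b c d + f a b e d = ins (ed a r1) (T c d + T e d) - ins (ed r1 b) (T c d + T e d)"
      "f a b c d + f a b c e = ins (ed a r1) (T c d + T c e) - ins (ed r1 b) (T c d + T c e)"
      by (simp_all add: f linear_simps)
    then show "f a b c d + f a b e d \<in> bdy (Suc (Suc (Suc s))) V" "f a b c d + f a b c e \<in> bdy (Suc (Suc (Suc s))) V"
      using ins_diff_bdy [OF T_diff1 [OF cols(3,4,5) cde] ar * V'] ins_diff_bdy [OF T_diff2 [OF cols(3,4,5) cde] ar * V']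
      by simp_all
  qed
  have skew: "f b a c d = - f a b c d" if "a \<in> L" "b \<in> L" for a b c d
    using that by (simp add: f comm [of r1])
  have tri: "f a b c d = - f b e c d - f e a c d" if "a \<in> L" "b \<in> L" "e \<in> L" for a b c d e
    using that by (simp add: f comm [of r1])
  \<comment> \<open>Exchanges put \<open>e\<close> into the last triangle; the double supplies one
    copy for each choice of the column in the other two-row triangle. Then \<open>tri\<close>
    expands both doubles over the four pairs with one column from \<open>{a, b}\<close> and one from
    \<open>{c, d}\<close>, where they agree by \<open>A3\<close> to \<open>A6\<close>.\<close>
  have quad: "f a b c d + f a b c d - f c d a b - f c d a b \<in> bdy (Suc (Suc (Suc s))) V"
    if cols: "a \<in> L" "b \<in> L" "c \<in> L" "d \<in> L" "e \<in> L" "distinct [a, b, c, d, e]" for a b c d e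
  proof -
    define B1 where "B1 = f a b c d + f a b c e"
    define B2 where "B2 = f c d a b + f c d a e"
    define A1 where "A1 = f a b c e + f a b d e"
    define A2 where "A2 = f c d a e + f c d b e"
    define A3 where "A3 = f b c d e + f b c a e"
    define A4 where "A4 = f c a d e + f c a b e"
    define A5 where "A5 = f b d c e + f b d a e"
    define A6 where "A6 = f d a c e + f d a b e"
    have mem: "B1 \<in> bdy (Suc (Suc (Suc s))) V" "B2 \<in> bdy (Suc (Suc (Suc s))) V"
      "A1 \<in> bdy (Suc (Suc (Suc s))) V" "A2 \<in> bdy (Suc (Suc (Suc s))) V"
      "A3 \<in> bdy (Suc (Suc (Suc s))) V" "A4 \<in> bdy (Suc (Suc (Suc s))) V"
      "A5 \<in> bdy (Suc (Suc (Suc s))) V" "A6 \<in> bdy (Suc (Suc (Suc s))) V"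
      unfolding B1_def B2_def A1_def A2_def A3_def A4_def A5_def A6_def
      using B [of a b c d e] B [of c d a b e] A [of a b c e d] A [of c d a e b]
        A [of b c d e a] A [of c a d e b] A [of b d c e a] A [of d a c e b] cols by auto
    have "f a b c d + f a b c d - f c d a b - f c d a b
        = B1 + B1 - B2 - B2 - A1 + A2 - f a b c e + f a b d e + f c d a e - f c d b e"
      by (simp add: B1_def B2_def A1_def A2_def)
    also have "f a b d e = - f b c d e - f c a d e" by (rule tri) (use cols in auto)
    also have "f a b c e = - f b d c e - f d a c e" by (rule tri) (use cols in auto)
    also have "f c d b e = - f d a b e - f a c b e" by (rule tri) (use cols in auto)
    also have "f a c b e = - f c a b e" by (rule skew) (use cols in auto)
    also have "f c d a e = - f d b a e - f b c a e" by (rule tri) (use cols in auto)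
    also have "f d b a e = - f b d a e" by (rule skew) (use cols in auto)
    finally have "f a b c d + f a b c d - f c d a b - f c d a b = B1 + B1 - B2 - B2 - A1 + A2 - A3 - A4 + A5 + A6"
      by (simp add: A3_def A4_def A5_def A6_def algebra_simps)
    moreover have "\<dots> \<in> bdy (Suc (Suc (Suc s))) V" using mem by (intro bdy_add bdy_diff)
    ultimately show ?thesis by simp
  qed
  \<comment> \<open>The three pairs among the columns \<open>c1, c2, c5\<close>, taken cyclically:
    \<open>g + x + y = 0\<close> holds exactly. Comparison with the pair \<open>c3, c4\<close> shows
    that twice \<open>x\<close> and twice \<open>y\<close> are homologous to twice \<open>g\<close>;
    together this gives the factor 6.\<close>
  define g where "g = f c1 c2 c3 c4"
  define x where "x = f c5 c1 c3 c4"
  define y where "y = f c2 c5 c3 c4"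
  have "g + g - x - x \<in> bdy (Suc (Suc (Suc s))) V"
  proof -
    have "f c1 c2 c3 c4 + f c1 c2 c3 c4 - f c3 c4 c1 c2 - f c3 c4 c1 c2 \<in> bdy (Suc (Suc (Suc s))) V"
      "f c1 c5 c3 c4 + f c1 c5 c3 c4 - f c3 c4 c1 c5 - f c3 c4 c1 c5 \<in> bdy (Suc (Suc (Suc s))) V"
      by (rule quad [where e = c5], use dist(2) L in auto) (rule quad [where e = c2], use dist(2) L in auto)
    moreover have "f c3 c4 c1 c2 + f c3 c4 c1 c5 \<in> bdy (Suc (Suc (Suc s))) V"
      by (rule B) (use dist(2) L in auto)
    ultimately have "(f c1 c2 c3 c4 + f c1 c2 c3 c4 - f c3 c4 c1 c2 - f c3 c4 c1 c2)
       + (f c1 c5 c3 c4 + f c1 c5 c3 c4 - f c3 c4 c1 c5 - f c3 c4 c1 c5)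
       + (f c3 c4 c1 c2 + f c3 c4 c1 c5) + (f c3 c4 c1 c2 + f c3 c4 c1 c5) \<in> bdy (Suc (Suc (Suc s))) V"
      by (meson bdy_add)
    moreover have "f c1 c5 c3 c4 = - x" by (simp add: x_def skew [of c5 c1] L)
    ultimately show ?thesis by (simp add: g_def algebra_simps)
  qed
  moreover have "g + g - y - y \<in> bdy (Suc (Suc (Suc s))) V"
  proof -
    have "f c1 c2 c3 c4 + f c1 c2 c3 c4 - f c3 c4 c1 c2 - f c3 c4 c1 c2 \<in> bdy (Suc (Suc (Suc s))) V"
      "f c5 c2 c3 c4 + f c5 c2 c3 c4 - f c3 c4 c5 c2 - f c3 c4 c5 c2 \<in> bdy (Suc (Suc (Suc s))) V"
      by (rule quad [where e = c5], use dist(2) L in auto) (rule quad [where e = c1], use dist(2) L in auto)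
    moreover have "f c3 c4 c1 c2 + f c3 c4 c5 c2 \<in> bdy (Suc (Suc (Suc s))) V"
      by (rule A) (use dist(2) L in auto)
    ultimately have "(f c1 c2 c3 c4 + f c1 c2 c3 c4 - f c3 c4 c1 c2 - f c3 c4 c1 c2)
       + (f c5 c2 c3 c4 + f c5 c2 c3 c4 - f c3 c4 c5 c2 - f c3 c4 c5 c2)
       + (f c3 c4 c1 c2 + f c3 c4 c5 c2) + (f c3 c4 c1 c2 + f c3 c4 c5 c2) \<in> bdy (Suc (Suc (Suc s))) V"
      by (meson bdy_add)
    moreover have "f c5 c2 c3 c4 = - y" by (simp add: y_def skew [of c2 c5] L)
    ultimately show ?thesis by (simp add: g_def algebra_simps)
  qed
  ultimately have "(g + g - x - x) + (g + g - y - y) \<in> bdy (Suc (Suc (Suc s))) V" by (rule bdy_add)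
  moreover have "g = - y - x" unfolding g_def x_def y_def by (rule tri) (use L in auto)
  then have "frag_cmul 6 g = (g + g - x - x) + (g + g - y - y)"
    by (intro poly_mapping_eqI) (simp add: lookup_add lookup_minus)
  ultimately show ?thesis by (simp add: g_def f_def)
qed

end

section \<open>Transport along monotone relabellings\<close>

text \<open>No sign is attached, since a strictly monotone \<open>f\<close> keeps the order inside
  every set and with it every \<open>edge_sign\<close>.\<close>

definition relabel :: "('a \<Rightarrow> 'b) \<Rightarrow> ('a set \<Rightarrow>\<^sub>0 int) \<Rightarrow> ('b set \<Rightarrow>\<^sub>0 int)"
  where "relabel f = frag_extend (\<lambda>\<sigma>. frag_of (f ` \<sigma>))"

lemma relabel_simps [simp]:
  "relabel f 0 = 0" "relabel f (frag_cmul k a) = frag_cmul k (relabel f a)" "relabel f (frag_of \<sigma>) = frag_of (f ` \<sigma>)"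
  by (simp_all add: relabel_def frag_extend_cmul)

lemma relabel_add: "relabel f (a + b) = relabel f a + relabel f b"
  by (simp add: relabel_def frag_extend_add)

lemma relabel_diff: "relabel f (a - b) = relabel f a - relabel f b"
  by (simp add: relabel_def frag_extend_diff)

lemma relabel_sum: "relabel f (sum g I) = (\<Sum>i\<in>I. relabel f (g i))"
  by (induction I rule: infinite_finite_induct) (auto simp: relabel_add)

context
  fixes f :: "'a::linorder \<Rightarrow> 'b::linorder"
  assumes f: "strict_mono f"
begin

lemma edge_sign_image: "edge_sign (f e) (f ` \<sigma>) = edge_sign e \<sigma>"
proof -
  have "{u \<in> f ` \<sigma>. u < f e} = f ` {u \<in> \<sigma>. u < e}"
    using strict_mono_less [OF f] by auto
  then show ?thesis
    using strict_mono_imp_inj_on [OF f] by (simp add: edge_sign_def card_image inj_on_subset)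
qed

lemma relabel_ins: "relabel f (ins e c) = ins (f e) (relabel f c)"
proof -
  have inj: "inj f" using f by (rule strict_mono_imp_inj_on)
  have "Poly_Mapping.keys c \<subseteq> UNIV" by simp
  then show ?thesis
    by (induction c rule: frag_induction)
      (auto simp: linear_simps relabel_diff ins_frag_of edge_sign_image inj_image_mem_iff [OF inj])
qed

lemma relabel_del: "relabel f (del e c) = del (f e) (relabel f c)"
proof -
  have inj: "inj f" using f by (rule strict_mono_imp_inj_on)
  have "Poly_Mapping.keys c \<subseteq> UNIV" by simp
  then show ?thesis
    by (induction c rule: frag_induction)
      (auto simp: linear_simps relabel_diff del_frag_of edge_sign_image inj_image_mem_iff [OF inj] image_set_diff [OF inj])
qed

lemma relabel_bd: "relabel f (bd c) = bd (relabel f c)"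
proof -
  have inj: "inj f" using f by (rule strict_mono_imp_inj_on)
  have 1: "relabel f (bd (frag_of \<sigma>)) = bd (relabel f (frag_of \<sigma>))" for \<sigma>
  proof -
    have "bd (frag_of (f ` \<sigma>)) = (\<Sum>v\<in>\<sigma>. del (f v) (frag_of (f ` \<sigma>)))"
      unfolding bd_frag_of by (rule sum.reindex_cong [of f]) (use inj in \<open>auto intro: inj_on_subset\<close>)
    then show ?thesis by (simp add: bd_frag_of relabel_sum relabel_del)
  qed
  have "Poly_Mapping.keys c \<subseteq> UNIV" by simp
  then show ?thesis
    by (induction c rule: frag_induction) (simp_all only: 1 linear_simps relabel_diff bd_simps relabel_simps)
qed

end

section \<open>The chessboard inside a complete graph\<close>

definition complete_edge :: "nat \<Rightarrow> nat \<Rightarrow> edge"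
  where "complete_edge a b = Edge (min a b) (max a b)"

fun complete_ends :: "edge \<Rightarrow> nat set"
  where "complete_ends (Edge a b) = {a, b}"

fun board_edge :: "nat + nat \<Rightarrow> nat + nat \<Rightarrow> edge"
  where "board_edge (Inl i) (Inr j) = Edge i j"
  | "board_edge (Inr j) (Inl i) = Edge i j"
  | "board_edge _ _ = undefined"

definition board_adj :: "nat + nat \<Rightarrow> nat + nat \<Rightarrow> bool"
  where "board_adj a b \<longleftrightarrow> isl a \<noteq> isl b"

interpretation K: complete_graph "\<lambda>a b. a \<noteq> b" complete_edge complete_ends
  by unfold_locales (auto simp: complete_edge_def min_def max_def)

interpretation B: simple_graph board_adj board_edge edge_ends
proof
  fix a b :: "nat + nat"
  assume "board_adj a b"
  then show "board_adj b a" "a \<noteq> b" "board_edge a b = board_edge b a" "edge_ends (board_edge a b) = {a, b}"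
    by (cases a; cases b; auto simp: board_adj_def)+
qed

lemma board_adj_simps [simp]:
  "board_adj (Inl i) (Inr j)" "board_adj (Inr j) (Inl i)"
  by (simp_all add: board_adj_def)

lemma board_edges [simp]: "e \<in> B.edges"
proof (cases e)
  case (Edge i j)
  then show ?thesis using B.edges_iff [of "Inl i" "Inr j"] by simp
qed

text \<open>Columns are numbered after all rows: the edges then have the form
  \<open>Edge (min a b) (max a b)\<close> of the complete graph, and their lexicographic order is
  preserved.\<close>

definition shift_edge :: "nat \<Rightarrow> edge \<Rightarrow> edge"
  where "shift_edge M e = (case e of Edge i j \<Rightarrow> Edge i (M + j))"

definition number_vertex :: "nat \<Rightarrow> nat + nat \<Rightarrow> nat"
  where "number_vertex M = case_sum id ((+) M)"

text \<open>Rows up to \<open>M\<close> and columns from 1 on: this keeps \<open>i < M + j\<close>,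
  so rows and columns receive different numbers.\<close>

definition board :: "nat \<Rightarrow> (nat + nat) set"
  where "board M = Inl ` {..M} \<union> Inr ` {1..}"

lemma strict_mono_shift_edge: "strict_mono (shift_edge M)"
proof
  fix x y :: edge
  assume "x < y"
  then show "shift_edge M x < shift_edge M y"
    by (cases x; cases y) (auto simp: shift_edge_def less_edge_def)
qed

lemma inj_on_number_vertex: "inj_on (number_vertex M) (board M)"
  by (auto simp: inj_on_def number_vertex_def board_def)

lemma shift_board_edge:
  assumes "a \<in> board M" "b \<in> board M" "board_adj a b"
  shows "shift_edge M (board_edge a b) = complete_edge (number_vertex M a) (number_vertex M b)"
  using assms by (cases a; cases b) (auto simp: board_def shift_edge_def number_vertex_def board_adj_def complete_edge_def min_def max_def)

lemma complete_ends_shift: "complete_ends (shift_edge M e) = number_vertex M ` edge_ends e"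
  by (cases e) (auto simp: shift_edge_def number_vertex_def)

lemma relabel_ch:
  assumes "V \<subseteq> board M" "c \<in> B.ch s V"
  shows "relabel (shift_edge M) c \<in> K.ch s (number_vertex M ` V)"
  using assms(2)
proof (induction c rule: B.ch_induct)
  case (one \<sigma>)
  let ?f = "shift_edge M"
  have inj: "inj ?f" using strict_mono_shift_edge by (rule strict_mono_imp_inj_on)
  have V: "edge_ends e \<subseteq> V" if "e \<in> \<sigma>" for e
    using one that by (auto simp: B.matchings_def)
  have fin: "finite \<sigma>" "card \<sigma> = s" "pairwise (\<lambda>e f. disjnt (edge_ends e) (edge_ends f)) \<sigma>"
    using one by (auto simp: B.matchings_def)
  have "?f e \<in> K.edges" if "e \<in> \<sigma>" for e
  proof -
    obtain a b where ab: "board_adj a b" "e = board_edge a b" "edge_ends e = {a, b}"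
      using B.edgesE [OF board_edges] by metis
    then have "a \<in> board M" "b \<in> board M" "a \<noteq> b" using V [OF that] assms(1) B.adj_irrefl by auto
    then show ?thesis
      using shift_board_edge [of a M b] ab inj_onD [OF inj_on_number_vertex, of M a b] by (auto simp: K.edges_def)
  qed
  moreover have "complete_ends (?f e) \<subseteq> number_vertex M ` V" if "e \<in> \<sigma>" for e
    using V [OF that] by (auto simp: complete_ends_shift)
  moreover have "disjnt (complete_ends (?f e)) (complete_ends (?f e'))" if "e \<in> \<sigma>" "e' \<in> \<sigma>" "e \<noteq> e'" for e e'
  proof -
    have "disjnt (edge_ends e) (edge_ends e')" using fin(3) that by (auto simp: pairwise_def)
    moreover have "edge_ends e \<subseteq> board M" "edge_ends e' \<subseteq> board M" using V that assms(1) by blast+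
    ultimately show ?thesis
      using inj_on_image_Int [OF inj_on_number_vertex, of "edge_ends e" M "edge_ends e'"]
      by (auto simp: complete_ends_shift disjnt_def)
  qed
  moreover have "card (?f ` \<sigma>) = s" using fin inj by (simp add: card_image inj_on_subset)
  ultimately have "?f ` \<sigma> \<in> K.matchings s (number_vertex M ` V)"
    using fin by (auto simp: K.matchings_def intro!: pairwise_imageI)
  then show ?case by simp
qed (auto simp: relabel_diff intro: K.ch_diff)

lemma relabel_zl:
  assumes "set l \<subseteq> board M" "B.path_triples l"
  shows "relabel (shift_edge M) (B.zl l x) = K.zl (map (number_vertex M) l) (relabel (shift_edge M) x)"
  using assms
  by (induction l x rule: B.zl.induct)
    (auto simp: relabel_diff relabel_ins [OF strict_mono_shift_edge] shift_board_edge)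

text \<open>A filling on the board would become one in the complete graph, but the functional takes
  twice a sign as its value there, which is nonzero modulo 3.\<close>

lemma zl_not_bdy:
  assumes "distinct l" "set l \<subseteq> V" "V \<subseteq> board M" "finite V" "card V = 3 * k + 1" "length l = 3 * k" "B.path_triples l"
  shows "frag_cmul 2 (B.zl l (frag_of {})) \<notin> B.bdy k V"
proof
  assume "frag_cmul 2 (B.zl l (frag_of {})) \<in> B.bdy k V"
  then obtain y where y: "y \<in> B.ch (Suc k) V" "frag_cmul 2 (B.zl l (frag_of {})) = bd y"
    by (auto simp: B.bdy_def)
  let ?\<nu> = "number_vertex M" and ?r = "relabel (shift_edge M)"
  have inj: "inj_on ?\<nu> V" using inj_on_number_vertex assms(3) by (rule inj_on_subset)
  have "card (V - set l) = 1"
    using assms by (simp add: card_Diff_subset distinct_card)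
  then obtain x where x: "V - set l = {x}" by (auto simp: card_1_singleton_iff)
  define l' where "l' = map ?\<nu> (l @ [x])"
  have l': "distinct l'" "set l' = ?\<nu> ` V"
  proof -
    have lx: "set (l @ [x]) = V" "distinct (l @ [x])" using x assms(1,2) by auto
    then show "set l' = ?\<nu> ` V" unfolding l'_def by (metis set_map)
    show "distinct l'" unfolding l'_def using lx inj by (simp only: distinct_map)
  qed
  have "K.zl l' (frag_of {}) = K.zl (map ?\<nu> l) (frag_of {})"
    unfolding l'_def using assms(6) by (simp add: K.zl_append)
  also have "\<dots> = ?r (B.zl l (frag_of {}))"
    using relabel_zl [of l M "frag_of {}"] assms by simp
  finally have z: "K.zl l' (frag_of {}) = ?r (B.zl l (frag_of {}))" .
  obtain w where w: "K.omega k (?\<nu> ` V) w"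
    using K.omega_exists [of "?\<nu> ` V" k] assms(4,5) card_image [OF inj] by auto
  have cyc: "K.zl l' (frag_of {}) \<in> K.cyc k (?\<nu> ` V)"
    by (rule K.zl_cyc_empty) (use l' assms in \<open>auto simp: l'_def\<close>)
  have "?r (bd y) \<in> K.bdy k (?\<nu> ` V)"
    unfolding relabel_bd [OF strict_mono_shift_edge] by (intro K.bdyI relabel_ch assms y)
  then have "K.zl l' (frag_of {}) + K.zl l' (frag_of {}) \<in> K.bdy k (?\<nu> ` V)"
    unfolding y(2) [symmetric] z relabel_simps by (simp only: frag_cmul_2)
  then have "w (K.zl l' (frag_of {})) + w (K.zl l' (frag_of {})) = 0"
    using w cyc by (auto simp: K.omega_def)
  then have "w (K.zl l' (frag_of {})) = 0" unfolding double_mod3 by simp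
  then have "(of_int (lsgn l') :: 3) = 0" using w l' by (simp add: K.omega_def)
  then have "(of_int (lsgn l' * lsgn l') :: 3) = 0" by (simp only: of_int_mult mult_zero_left)
  then show False by simp
qed

section \<open>The fundamental cycle of the chessboard complex with one excess column\<close>

text \<open>Signed sum over the injections of the rows into \<open>S\<close>, expanded along the
  first row like a determinant. With one excess column this is the fundamental cycle of an
  orientable pseudomanifold.\<close>

fun fundamental_chain :: "nat list \<Rightarrow> nat set \<Rightarrow> (edge set \<Rightarrow>\<^sub>0 int)"
  where "fundamental_chain [] S = frag_of {}"
  | "fundamental_chain (r # rs) S =
      (\<Sum>c\<in>S. frag_cmul (edge_sign c S) (ins (Edge r c) (fundamental_chain rs (S - {c}))))"

lemma fundamental_chain_ch:
  assumes "distinct rs"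
  shows "fundamental_chain rs S \<in> B.ch (length rs) (Inl ` set rs \<union> Inr ` S)"
  using assms
proof (induction rs arbitrary: S)
  case Nil
  then show ?case by (simp add: B.matchings_def)
next
  case (Cons r rs)
  have "ins (Edge r c) (fundamental_chain rs (S - {c})) \<in> B.ch (Suc (length rs)) (Inl ` set (r # rs) \<union> Inr ` S)"
    if "c \<in> S" for c
    by (rule B.ins_ch [OF Cons.IH]) (use Cons.prems that in auto)
  then show ?case by (auto intro!: B.ch_sum B.ch_cmul)
qed

lemma edge_sign_pair:
  assumes "x \<noteq> y"
  shows "edge_sign y {x, y} = - edge_sign x {x, y}"
proof -
  have e: "edge_sign z {} = 1" for z :: 'a by (simp add: edge_sign_def)
  have "edge_sign y {x, y} = edge_sign y {x}"
    unfolding insert_commute [of x y] by simp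
  moreover have "x < y \<or> y < x" using assms by (simp add: neq_iff)
  ultimately show ?thesis
    using edge_sign_insert [of "{}" x y] edge_sign_insert [of "{}" y x] e
    by (elim disjE) simp_all
qed

text \<open>This sum is what the boundary of a chain with one more row leaves once the edges of that
  row are deleted. Fixing the column of the first row in \<open>rs\<close> reduces it to fewer rows,
  because removing two columns in the other order flips the sign; with no rows two opposite terms
  cancel.\<close>

lemma fundamental_chain_alternating:
  assumes "finite S" "card S = length rs + 2"
  shows "(\<Sum>c\<in>S. frag_cmul (edge_sign c S) (fundamental_chain rs (S - {c}))) = 0"
  using assms
proof (induction rs arbitrary: S)
  case Nil
  then have "card S = 2" by simp
  then obtain x y where "S = {x, y}" "x \<noteq> y" by (auto simp: card_2_iff)
  then show ?case using edge_sign_pair [of x y] by (simp flip: minus_frag_cmul)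
next
  case (Cons r rs)
  define h where "h c c' = frag_cmul (edge_sign c S * edge_sign c' (S - {c}))
    (ins (Edge r c') (fundamental_chain rs (S - {c} - {c'})))" for c c'
  have swap: "edge_sign c S * edge_sign c' (S - {c}) = - (edge_sign c' S * edge_sign c (S - {c'}))"
    if "c \<in> S" "c' \<in> S" "c \<noteq> c'" for c c'
  proof -
    define S' where "S' = S - {c, c'}"
    have S': "finite S'" "c \<notin> S'" "c' \<notin> S'" "S - {c} = insert c' S'" "S - {c'} = insert c S'"
      "S = insert c (insert c' S')" "S = insert c' (insert c S')"
      using that Cons.prems(1) by (auto simp: S'_def)
    have "edge_sign c S = edge_sign c (insert c' S')" "edge_sign c' S = edge_sign c' (insert c S')"
      by (subst S'(6), simp) (subst S'(7), simp)
    then show ?thesis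
      unfolding S'(4,5) using edge_sign_insert [OF S'(1,2), of c'] edge_sign_insert [OF S'(1,3), of c] that(3)
      by auto
  qed
  have inner: "(\<Sum>c\<in>S - {c'}. h c c') = 0" if c': "c' \<in> S" for c'
  proof -
    have "(\<Sum>c\<in>S - {c'}. h c c') = (\<Sum>c\<in>S - {c'}. frag_cmul (- edge_sign c' S) (ins (Edge r c')
        (frag_cmul (edge_sign c (S - {c'})) (fundamental_chain rs (S - {c'} - {c})))))"
    proof (rule sum.cong [OF refl])
      fix c assume "c \<in> S - {c'}"
      moreover have "S - {c'} - {c} = S - {c} - {c'}" by auto
      ultimately show "h c c' = frag_cmul (- edge_sign c' S) (ins (Edge r c')
          (frag_cmul (edge_sign c (S - {c'})) (fundamental_chain rs (S - {c'} - {c}))))"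
        using swap [of c c'] c' by (simp add: h_def)
    qed
    also have "\<dots> = frag_cmul (- edge_sign c' S) (ins (Edge r c')
        (\<Sum>c\<in>S - {c'}. frag_cmul (edge_sign c (S - {c'})) (fundamental_chain rs (S - {c'} - {c}))))"
      by (simp only: frag_cmul_sum ins_sum)
    also have "\<dots> = 0"
      using Cons.IH [of "S - {c'}"] Cons.prems c' by simp
    finally show ?thesis .
  qed
  have "(\<Sum>c\<in>S. frag_cmul (edge_sign c S) (fundamental_chain (r # rs) (S - {c}))) = (\<Sum>c\<in>S. \<Sum>c'\<in>S - {c}. h c c')"
    by (simp add: h_def frag_cmul_sum)
  also have "\<dots> = (\<Sum>(c, c')\<in>Sigma S (\<lambda>c. S - {c}). h c c')"
    using Cons.prems by (simp add: sum.Sigma)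
  also have "\<dots> = (\<Sum>(c', c)\<in>Sigma S (\<lambda>c'. S - {c'}). h c c')"
    by (rule sum.reindex_bij_witness [of _ prod.swap prod.swap]) auto
  also have "\<dots> = (\<Sum>c'\<in>S. \<Sum>c\<in>S - {c'}. h c c')"
    using Cons.prems by (simp add: sum.Sigma)
  also have "\<dots> = 0" using inner by simp
  finally show ?case .
qed

lemma fundamental_chain_cyc:
  assumes "distinct rs" "finite S" "card S = length rs + 1"
  shows "fundamental_chain rs S \<in> B.cyc (length rs) (Inl ` set rs \<union> Inr ` S)"
proof -
  have "bd (fundamental_chain rs S) = 0"
    using assms
  proof (induction rs arbitrary: S)
    case (Cons r rs)
    have fin: "fin_chain (fundamental_chain rs (S - {c}))" for c
      using B.ch_fin [OF fundamental_chain_ch] Cons.prems by simp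
    have "bd (ins (Edge r c) (fundamental_chain rs (S - {c}))) = fundamental_chain rs (S - {c})" if "c \<in> S" for c
      using Cons.IH [of "S - {c}"] Cons.prems that by (simp add: bd_ins fin)
    then have "bd (fundamental_chain (r # rs) S) = (\<Sum>c\<in>S. frag_cmul (edge_sign c S) (fundamental_chain rs (S - {c})))"
      by (simp add: linear_simps)
    also have "\<dots> = 0" using Cons.prems by (intro fundamental_chain_alternating) auto
    finally show ?case .
  qed simp
  then show ?thesis using fundamental_chain_ch [OF assms(1)] by (simp add: B.cyc_def)
qed

lemma del_fundamental_chain:
  assumes "distinct (r # rs)" "finite S" "c \<in> S"
  shows "del (Edge r c) (fundamental_chain (r # rs) S) = frag_cmul (edge_sign c S) (fundamental_chain rs (S - {c}))"
proof -
  have *: "del (Edge r c) (ins (Edge r c') (fundamental_chain rs (S - {c'}))) = (if c' = c then fundamental_chain rs (S - {c}) else 0)"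
    for c'
  proof -
    have ch: "fundamental_chain rs (S - {c'}) \<in> B.ch (length rs) (Inl ` set rs \<union> Inr ` (S - {c'}))"
      by (rule fundamental_chain_ch) (use assms in auto)
    have "del (Edge r c) (fundamental_chain rs (S - {c'})) = 0"
      by (rule B.del_outside [OF ch]) (use assms in auto)
    then show ?thesis using B.ch_fin [OF ch] by (auto simp: del_ins del_ins_same)
  qed
  have "del (Edge r c) (fundamental_chain (r # rs) S)
      = (\<Sum>c'\<in>S. if c' = c then frag_cmul (edge_sign c S) (fundamental_chain rs (S - {c})) else 0)"
    unfolding fundamental_chain.simps linear_simps del_simps * by (rule sum.cong) auto
  then show ?thesis using assms by simp
qed

text \<open>Contracting along one edge per row of the fundamental cycle leaves a product of triangles.\<close>

lemma zl_fundamental_not_bdy: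
  assumes "rs \<noteq> []" "distinct rs" "finite S" "card S = length rs + 1"
    and "distinct l" "B.path_triples l" "length l = 3 * t" "set l \<inter> (Inl ` set rs \<union> Inr ` S) = {}"
    and "set l \<union> (Inl ` set rs \<union> Inr ` S) \<subseteq> V" "V \<subseteq> board M" "finite V"
    and "card V = 3 * t + 2 * length rs + 2"
  shows "frag_cmul 2 (B.zl l (fundamental_chain rs S)) \<notin> B.bdy (t + length rs) V"
  using assms
proof (induction rs arbitrary: S V)
  case (Cons r rs)
  show ?case
  proof (cases "rs = []")
    \<comment> \<open>The induction stops at one row, where the fundamental cycle is up to sign one
      more triangle and \<open>V\<close> has \<open>3 * (t + 1) + 1\<close> vertices. With no row
      there would be \<open>3 * t + 2\<close>, and on that many vertices of the complete graph
      products of \<open>t\<close> triangles bound.\<close>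
    case True
    then have "card S = 2" using Cons.prems by simp
    then obtain x y where S: "S = {x, y}" "x \<noteq> y" by (auto simp: card_2_iff)
    have xy: "edge_sign y {x, y} = - edge_sign x {x, y}" using S(2) by (rule edge_sign_pair)
    define z where "z = B.zl (l @ [Inr x, Inl r, Inr y]) (frag_of {})"
    have "fundamental_chain [r] S = frag_cmul (edge_sign x {x, y}) (ins (Edge r x) (frag_of {}) - ins (Edge r y) (frag_of {}))"
      using S xy by (simp add: frag_cmul_diff_distrib2)
    then have "B.zl l (fundamental_chain [r] S) = frag_cmul (edge_sign x {x, y}) z"
      using Cons.prems(7) by (simp add: z_def B.zl_append B.zl_cmul)
    then have *: "frag_cmul 2 z = frag_cmul (edge_sign x {x, y}) (frag_cmul 2 (B.zl l (fundamental_chain [r] S)))"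
      by (simp add: mult.left_commute [of _ 2])
    have "frag_cmul 2 z \<notin> B.bdy (t + 1) V"
      unfolding z_def
      by (rule zl_not_bdy [where M = M])
        (use Cons.prems S True in \<open>auto simp: B.path_triples_append\<close>)
    moreover have "frag_cmul 2 (B.zl l (fundamental_chain [r] S)) \<in> B.bdy (t + 1) V"
      if "frag_cmul 2 (B.zl l (fundamental_chain (r # rs) S)) \<in> B.bdy (t + length (r # rs)) V"
      using that unfolding True by (simp del: fundamental_chain.simps)
    ultimately show ?thesis using * B.bdy_cmul by metis
  next
    case False
    obtain c where c: "c \<in> S" using Cons.prems by fastforce
    let ?V = "V - {Inl r, Inr c}"
    have fin: "fin_chain (fundamental_chain (r # rs) S)"
      using B.ch_fin [OF fundamental_chain_ch] Cons.prems by blast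
    have V: "Inl r \<in> V" "Inr c \<in> V" using Cons.prems c by auto
    have IH: "frag_cmul 2 (B.zl l (fundamental_chain rs (S - {c}))) \<notin> B.bdy (t + length rs) ?V"
    proof (rule Cons.IH [OF False])
      have "card ?V = card V - card {Inl r :: nat + nat, Inr c}"
        by (rule card_Diff_subset) (use V in auto)
      then show "card ?V = 3 * t + 2 * length rs + 2" using Cons.prems by simp
      show "set l \<union> (Inl ` set rs \<union> Inr ` (S - {c})) \<subseteq> ?V" using Cons.prems c by auto
      show "?V \<subseteq> board M" using Cons.prems by blast
    qed (use Cons.prems c in auto)
    \<comment> \<open>Moving the contraction past the \<open>t\<close> factors of \<open>l\<close>
      contributes the parity of \<open>t\<close>.\<close>
    define \<epsilon> :: int where "\<epsilon> = (if even t then edge_sign c S else - edge_sign c S)"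
    have \<epsilon>: "\<epsilon> * \<epsilon> = 1" by (simp add: \<epsilon>_def)
    have "del (Edge r c) (B.zl l (fundamental_chain (r # rs) S)) = frag_cmul \<epsilon> (B.zl l (fundamental_chain rs (S - {c})))"
      using B.del_zl [OF fin Cons.prems(6), of "Edge r c"] Cons.prems c
        del_fundamental_chain [OF Cons.prems(2,3) c]
      by (auto simp: \<epsilon>_def B.zl_cmul)
    then have *: "frag_cmul 2 (B.zl l (fundamental_chain rs (S - {c})))
        = frag_cmul \<epsilon> (del (Edge r c) (frag_cmul 2 (B.zl l (fundamental_chain (r # rs) S))))"
      using \<epsilon> by (simp add: mult.left_commute [of _ 2])
    show ?thesis
    proof
      assume "frag_cmul 2 (B.zl l (fundamental_chain (r # rs) S)) \<in> B.bdy (t + length (r # rs)) V"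
      then have "frag_cmul 2 (B.zl l (fundamental_chain (r # rs) S)) \<in> B.bdy (Suc (t + length rs)) V"
        by (simp only: list.size add_Suc_right add_0_right)
      from B.del_bdy [OF this, of "Edge r c"]
      have "del (Edge r c) (frag_cmul 2 (B.zl l (fundamental_chain (r # rs) S))) \<in> B.bdy (t + length rs) ?V"
        by (simp only: edge_ends.simps)
      then show False using IH * B.bdy_cmul by metis
    qed
  qed
qed simp

section \<open>Elements of order three\<close>

text \<open>The list consists of \<open>p\<close> triangles with one row and two columns and
  \<open>q\<close> triangles with two rows and one column.\<close>

lemma board_triples_exist:
  assumes "finite R" "finite T" "card R = p + 2 * q" "card T = 2 * p + q"
  shows "\<exists>l. B.path_triples l \<and> distinct l \<and> set l = Inl ` R \<union> Inr ` T \<and> length l = 3 * (p + q)"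
  using assms
proof (induction p arbitrary: R T)
  case 0
  then show ?case
  proof (induction q arbitrary: R T)
    case 0
    then show ?case by (intro exI [of _ "[]"]) auto
  next
    case (Suc q)
    have "2 \<le> card R" using Suc.prems by simp
    then obtain x y where xy: "x \<in> R" "y \<in> R" "x \<noteq> y" by (rule two_elements)
    obtain c where c: "c \<in> T" using Suc.prems by fastforce
    have "card (R - {x, y}) = card R - card {x, y}" by (rule card_Diff_subset) (use xy in auto)
    then obtain l where "B.path_triples l" "distinct l" "set l = Inl ` (R - {x, y}) \<union> Inr ` (T - {c})" "length l = 3 * q"
      using Suc.IH [of "R - {x, y}" "T - {c}"] Suc.prems xy c by auto
    then show ?case
      using xy c by (intro exI [of _ "Inl x # Inr c # Inl y # l"]) auto
  qed
next
  case (Suc p)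
  have "2 \<le> card T" using Suc.prems by simp
  then obtain x y where xy: "x \<in> T" "y \<in> T" "x \<noteq> y" by (rule two_elements)
  obtain r where r: "r \<in> R" using Suc.prems by fastforce
  have "card (T - {x, y}) = card T - card {x, y}" by (rule card_Diff_subset) (use xy in auto)
  then obtain l where "B.path_triples l" "distinct l" "set l = Inl ` (R - {r}) \<union> Inr ` (T - {x, y})" "length l = 3 * (p + q)"
    using Suc.IH [of "R - {r}" "T - {x, y}"] Suc.prems xy r by auto
  then show ?case
    using xy r by (intro exI [of _ "Inr x # Inl r # Inr y # l"]) auto
qed

lemma upto_5: "{1..5::nat} = {1, 2, 3, 4, 5}"
  by auto

lemma torsion_cycle:
  assumes "s + 2 \<le> m" "s + 3 \<le> n" "m + n \<le> 3 * s + 1"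
  shows "\<exists>Z. Z \<in> B.cyc s (Inl ` {1..m} \<union> Inr ` {1..n}) \<and>
    frag_cmul 2 Z \<notin> B.bdy s (Inl ` {1..m} \<union> Inr ` {1..n}) \<and>
    frag_cmul 6 Z \<in> B.bdy s (Inl ` {1..m} \<union> Inr ` {1..n})"
proof -
  \<comment> \<open>Solved from the counts of rows, columns and edges: a 5 by 5 block with 3 edges
    and one free column, \<open>p + q\<close> further triangles of the two kinds, and a fundamental
    cycle on \<open>k + 1\<close> rows and \<open>k + 2\<close> columns. The hypotheses say that
    none of the three numbers is negative.\<close>
  define p where "p = n - s - 3"
  define q where "q = m - s - 2"
  define k where "k = 3 * s + 1 - m - n"
  have m: "m = p + 2 * q + k + 6" and n: "n = 2 * p + q + k + 7" and s: "s = p + q + k + 4"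
    using assms unfolding p_def q_def k_def by arith+
  define A where "A = 5 + p + 2 * q"
  define D where "D = 5 + 2 * p + q"
  define V :: "(nat + nat) set" where "V = Inl ` {1..m} \<union> Inr ` {1..n}"
  have AD: "5 \<le> A" "A \<le> m" "5 \<le> D" "D \<le> n" by (simp_all add: A_def D_def m n)
  obtain l where l: "B.path_triples l" "distinct l" "set l = Inl ` {6..A} \<union> Inr ` {6..D}" "length l = 3 * (p + q)"
    using board_triples_exist [of "{6..A}" "{6..D}" p q] by (auto simp: A_def D_def)
  define rs where "rs = [Suc A..<Suc m]"
  define S where "S = {Suc D..n}"
  have rs: "rs \<noteq> []" "distinct rs" "length rs = k + 1" "set rs = {Suc A..m}"
    by (auto simp: rs_def m A_def)
  have S: "finite S" "card S = length rs + 1" by (auto simp: S_def rs n D_def)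
  let ?W = "Inl ` set rs \<union> Inr ` S"
  define w where "w = fundamental_chain rs S"
  have w: "w \<in> B.cyc (k + 1) ?W"
    using fundamental_chain_cyc [OF rs(2) S] rs by (simp add: w_def)
  define t :: "(nat + nat) list"
    where "t = [Inr 1, Inl 1, Inr 2, Inl 2, Inr 3, Inl 3, Inl 4, Inr 4, Inl 5]"
  have t: "distinct t" "B.path_triples t" "length t = 9" "set t = Inl ` {1..5} \<union> Inr ` {1..4}"
    by (auto simp: t_def)
  define Z where "Z = B.zl (t @ l) w"
  have C: "B.zl l w \<in> B.cyc (k + 1 + length l div 3) (set l \<union> ?W)"
    by (rule B.zl_cyc [OF w l(1,2)]) (auto simp: l(3) rs(4) S_def)
  have Z: "Z = B.zl t (B.zl l w)" unfolding Z_def by (rule B.zl_append) (simp add: t)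
  have tl: "distinct (t @ l)" "B.path_triples (t @ l)" "length (t @ l) = 3 * (p + q + 3)"
    using t l by (auto simp: B.path_triples_append)
  have sub: "set (t @ l) \<inter> ?W = {}" "set (t @ l) \<union> ?W \<subseteq> V"
    unfolding set_append t(4) l(3) rs(4) S_def V_def using AD by auto
  have "Z \<in> B.cyc s V"
  proof -
    have "k + 1 + length (t @ l) div 3 = s" unfolding tl(3) s by simp
    then show ?thesis using B.zl_cyc [OF w tl(2,1) sub] by (simp only: Z_def)
  qed
  moreover have "frag_cmul 2 Z \<notin> B.bdy s V"
  proof -
    have "p + q + 3 + length rs = s" unfolding rs(3) s by simp
    moreover have "frag_cmul 2 Z \<notin> B.bdy (p + q + 3 + length rs) V"
      unfolding Z_def w_def
    proof (rule zl_fundamental_not_bdy [OF rs(1,2) S tl sub])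
      show "V \<subseteq> board m" by (auto simp: V_def board_def)
      show "finite V" by (simp add: V_def)
      have "card V = card (Inl ` {1..m} :: (nat + nat) set) + card (Inr ` {1..n} :: (nat + nat) set)"
        unfolding V_def by (rule card_Un_disjoint) auto
      then have "card V = m + n" by (simp add: card_image)
      then show "card V = 3 * (p + q + 3) + 2 * length rs + 2" using rs(3) m n by presburger
    qed
    ultimately show ?thesis by simp
  qed
  moreover have "frag_cmul 6 Z \<in> B.bdy s V"
  proof -
    have "Suc (Suc (Suc (k + 1 + length l div 3))) = s" unfolding l(4) s by simp
    moreover have "frag_cmul 6 Z \<in> B.bdy (Suc (Suc (Suc (k + 1 + length l div 3)))) V"
      unfolding Z t_def
    proof (rule B.six_torsion [OF C, where ?c5.0 = "Inr 5"])
      have eq: "{Inl 1, Inl 2, Inl 3, Inl 4, Inl 5, Inr 1, Inr 2, Inr 3, Inr 4, Inr 5}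
          = (Inl ` {1..5} \<union> Inr ` {1..5} :: (nat + nat) set)"
        unfolding upto_5 by auto
      show "{Inl 1, Inl 2, Inl 3, Inl 4, Inl 5, Inr 1, Inr 2, Inr 3, Inr 4, Inr 5} \<inter> (set l \<union> ?W) = {}"
        unfolding eq l(3) rs(4) S_def using AD by auto
      show "{Inl 1, Inl 2, Inl 3, Inl 4, Inl 5, Inr 1, Inr 2, Inr 3, Inr 4, Inr 5} \<union> (set l \<union> ?W) \<subseteq> V"
      proof -
        have "{1..5} \<subseteq> {1..m}" "{1..5} \<subseteq> {1..n}" using AD by auto
        then have "Inl ` {1..5} \<union> Inr ` {1..5} \<subseteq> V" unfolding V_def by (intro Un_mono image_mono)
        then show ?thesis unfolding eq using sub(2) by (simp only: set_append Un_subset_iff)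
      qed
      fix r c :: "nat + nat"
      assume "r \<in> {Inl 1, Inl 2, Inl 3, Inl 4, Inl 5}" "c \<in> {Inr 1, Inr 2, Inr 3, Inr 4, Inr 5}"
      then show "board_adj r c" by (elim insertE emptyE) (simp_all only: board_adj_simps)
    qed simp_all
    ultimately show ?thesis by simp
  qed
  ultimately show ?thesis
    unfolding V_def by blast
qed

section \<open>Passage to the reduced homology of the chessboard complex\<close>

lemma faces_chessboard_complex:
  assumes "p = int s - 1"
  shows "faces p (chessboard_complex m n) = B.matchings s (Inl ` {1..m} \<union> Inr ` {1..n})"
proof -
  let ?V = "Inl ` {1..m} \<union> Inr ` {1..n} :: (nat + nat) set"
  have "e \<in> complete_bipartite_edges m n \<longleftrightarrow> edge_ends e \<subseteq> ?V" for e
    by (cases e) (auto simp: complete_bipartite_edges_def)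
  then have sub: "M \<subseteq> complete_bipartite_edges m n \<longleftrightarrow> (\<forall>e\<in>M. edge_ends e \<subseteq> ?V)" for M
    by blast
  have fin: "finite M" if "M \<in> chessboard_complex m n" for M
    using complex_chessboard_complex [of m n] that by (simp add: abstract_simplicial_complex_def)
  have "int (card M) = p + 1 \<longleftrightarrow> card M = s" for M :: "edge set"
    using assms by simp
  then have 1: "M \<in> faces p (chessboard_complex m n) \<longleftrightarrow>
      M \<subseteq> complete_bipartite_edges m n \<and> matching M \<and> finite M \<and> card M = s" for M
    unfolding faces_def using fin [of M] by (simp add: chessboard_complex_def) blast
  have 2: "M \<in> B.matchings s ?V \<longleftrightarrow> (\<forall>e\<in>M. edge_ends e \<subseteq> ?V) \<and> matching M \<and> finite M \<and> card M = s" for M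
    unfolding B.matchings_def matching_def mem_Collect_eq using board_edges by blast
  show ?thesis
    by (rule Set.set_eqI) (simp only: 1 2 sub)
qed

lemma simplicial_chain_group_chessboard:
  "p = int s - 1 \<Longrightarrow> carrier (simplicial_chain_group p (chessboard_complex m n)) = B.ch s (Inl ` {1..m} \<union> Inr ` {1..n})"
  by (auto simp: simplicial_chain_group_def B.ch_def faces_chessboard_complex)

lemma homology_order_3:
  assumes K: "abstract_simplicial_complex K"
    and c: "c \<in> simplicial_cycles p K" "c \<notin> simplicial_boundaries p K"
      "frag_cmul 3 c \<in> simplicial_boundaries p K"
  shows "\<exists>x \<in> carrier (reduced_simplicial_homology p K). group.ord (reduced_simplicial_homology p K) x = 3"
proof -
  let ?Z = "subgroup_generated (simplicial_chain_group p K) (simplicial_cycles p K)"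
  let ?B = "simplicial_boundaries p K" and ?H = "reduced_simplicial_homology p K"
  have H: "?H = ?Z Mod ?B" by (simp add: reduced_simplicial_homology_def)
  have C: "comm_group (simplicial_chain_group p K)" "group (simplicial_chain_group p K)"
    by (simp_all add: simplicial_chain_group_def abelian_free_Abelian_group)
  interpret Z: comm_group ?Z
    using C by (simp add: group.abelian_subgroup_generated)
  have sub: "?B \<subseteq> carrier ?Z"
    using simplicial_boundary_closed [OF K, where p = "p + 1"]
      simplicial_boundary_boundary [OF K, where p = "p + 1"]
    unfolding carrier_simplicial_cycle_group
    by (auto simp: simplicial_boundaries_def simplicial_cycles_def)
  have hom: "group_hom (simplicial_chain_group (p + 1) K) ?Z simplicial_boundary"
  proof -
    have "simplicial_boundary \<in> hom (simplicial_chain_group (p + 1) K) ?Z"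
      using sub by (intro homI) (auto simp: simplicial_boundaries_def simplicial_chain_group_def bd_add)
    moreover have "group (simplicial_chain_group (p + 1) K)" by (simp add: simplicial_chain_group_def)
    ultimately show ?thesis by (simp add: group_hom_def group_hom_axioms_def)
  qed
  have "subgroup ?B ?Z"
    using group_hom.img_is_subgroup [OF hom] by (simp add: simplicial_boundaries_def)
  then interpret N: normal ?B ?Z by (rule Z.subgroup_imp_normal)
  interpret H: group ?H unfolding H by (rule N.factorgroup_is_group)
  have cZ: "c \<in> carrier ?Z" using c by (simp add: carrier_simplicial_cycle_group)
  define x where "x = ?B #>\<^bsub>?Z\<^esub> c"
  have x: "x \<in> carrier ?H"
    unfolding H x_def carrier_FactGroup using cZ by blast
  have pow: "c [^]\<^bsub>?Z\<^esub> (3::nat) = frag_cmul 3 c"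
    by (simp add: pow_subgroup_generated simplicial_chain_group_def)
  have "x [^]\<^bsub>?H\<^esub> (3::nat) = ?B #>\<^bsub>?Z\<^esub> (frag_cmul 3 c)"
    unfolding H x_def using N.FactGroup_pow [OF cZ, of 3] pow by simp
  also have "\<dots> = ?B" by (rule Z.coset_join2) (use c sub N.subgroup_axioms in auto)
  also have one: "?B = \<one>\<^bsub>?H\<^esub>" by (simp add: H FactGroup_def)
  finally have "x [^]\<^bsub>?H\<^esub> (3::nat) = \<one>\<^bsub>?H\<^esub>" .
  then have dvd: "H.ord x dvd 3" using H.pow_eq_id [OF x] by simp
  have "H.ord x \<le> 3" using dvd by (rule dvd_imp_le) simp
  \<comment> \<open>\<open>ord\<close> is 0 for elements of infinite order; divisibility of 3
    excludes this value as well as 2.\<close>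
  then have "H.ord x = 0 \<or> H.ord x = 1 \<or> H.ord x = 2 \<or> H.ord x = 3" by linarith
  then have "H.ord x = 1 \<or> H.ord x = 3" using dvd by auto
  moreover have "H.ord x \<noteq> 1"
  proof
    assume "H.ord x = 1"
    then have "x = \<one>\<^bsub>?H\<^esub>" using H.ord_eq_1 [OF x] by blast
    then have "?B #>\<^bsub>?Z\<^esub> c = ?B" unfolding one [symmetric] x_def .
    then have "c \<in> ?B" using Z.coset_join1 [OF _ cZ N.subgroup_axioms] by blast
    then show False using c(2) by contradiction
  qed
  ultimately show ?thesis using x by blast
qed

text \<open>With \<open>s = d + 1\<close> edges the ceiling bound reads
  \<open>m + n \<le> 3 * s + 1\<close>, and \<open>d \<le> m - 3\<close> reads
  \<open>s + 2 \<le> m\<close>. The condition \<open>s + 3 \<le> n\<close> then follows if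
  \<open>m < n\<close>, while for \<open>n = m\<close> it becomes \<open>d \<le> m - 4\<close>; this
  is how the two cases of the theorem arise.\<close>

theorem chessboard_3_torsion:
  fixes m n s :: nat
  assumes "s + 2 \<le> m" "s + 3 \<le> n" "m + n \<le> 3 * s + 1" and p: "p = int s - 1"
  shows "\<exists>x \<in> carrier (reduced_simplicial_homology p (chessboard_complex m n)).
    group.ord (reduced_simplicial_homology p (chessboard_complex m n)) x = 3"
proof -
  let ?V = "Inl ` {1..m} \<union> Inr ` {1..n} :: (nat + nat) set"
  obtain Z where Z: "Z \<in> B.cyc s ?V" "frag_cmul 2 Z \<notin> B.bdy s ?V" "frag_cmul 6 Z \<in> B.bdy s ?V"
    using torsion_cycle [OF assms(1-3)] by blast
  have cyc: "simplicial_cycles p (chessboard_complex m n) = B.cyc s ?V"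
    by (simp add: simplicial_cycles_def simplicial_chain_group_chessboard [OF p] B.cyc_def)
  have bdy: "simplicial_boundaries p (chessboard_complex m n) = B.bdy s ?V"
    using p by (simp add: simplicial_boundaries_def simplicial_chain_group_chessboard [of _ "Suc s"] B.bdy_def)
  show ?thesis
    by (rule homology_order_3 [of _ "frag_cmul 2 Z"])
      (use Z in \<open>auto simp: cyc bdy complex_chessboard_complex B.cyc_cmul\<close>)
qed

theorem theorem4p4:
  fixes m n :: nat and d :: int
  assumes "1 \<le> m" and "m \<le> n"
  shows "(m + 1 \<le> n \<and> int n \<le> 2 * int m - 5 \<and>
            \<lceil>(real m + real n - 4) / 3\<rceil> \<le> d \<and> d \<le> int m - 3 \<longrightarrow>
          (\<exists>x \<in> carrier (reduced_simplicial_homology d (chessboard_complex m n)).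
             group.ord (reduced_simplicial_homology d (chessboard_complex m n)) x = 3))
       \<and> (\<lceil>(2 * real m - 4) / 3\<rceil> \<le> d \<and> d \<le> int m - 4 \<longrightarrow>
          (\<exists>x \<in> carrier (reduced_simplicial_homology d (chessboard_complex m m)).
             group.ord (reduced_simplicial_homology d (chessboard_complex m m)) x = 3))"
proof (intro conjI impI; elim conjE)
  assume h: "m + 1 \<le> n" "\<lceil>(real m + real n - 4) / 3\<rceil> \<le> d" "d \<le> int m - 3"
  have "real_of_int (int m + int n - 4) \<le> real_of_int (3 * d)" using h(2) by (simp add: ceiling_le_iff)
  then have "int m + int n - 4 \<le> 3 * d" by (simp only: of_int_le_iff)
  then show "\<exists>x \<in> carrier (reduced_simplicial_homology d (chessboard_complex m n)).
             group.ord (reduced_simplicial_homology d (chessboard_complex m n)) x = 3"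
    using h by (intro chessboard_3_torsion [where s = "nat (d + 1)"]) auto
next
  assume h: "\<lceil>(2 * real m - 4) / 3\<rceil> \<le> d" "d \<le> int m - 4"
  have "real_of_int (2 * int m - 4) \<le> real_of_int (3 * d)" using h(1) by (simp add: ceiling_le_iff)
  then have "2 * int m - 4 \<le> 3 * d" by (simp only: of_int_le_iff)
  then show "\<exists>x \<in> carrier (reduced_simplicial_homology d (chessboard_complex m m)).
             group.ord (reduced_simplicial_homology d (chessboard_complex m m)) x = 3"
    using h by (intro chessboard_3_torsion [where s = "nat (d + 1)"]) auto
qed

end
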